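(* Let $C_6$ be the Cartan factor of type 6 and let $u,e\in C_6$ be two unitary elements. (i) $u\sim_{h,t}e$ if and only if $\operatorname{dt}u=\pm\operatorname{dt}e$. Moreover, in this case there is a chain of $\sim_h$ from $u$ to $e$ of length at most $5$. (ii) Always $u\sim_{hc,t}e$. Moreover, there is a chain of $\sim_{hc}$ from $u$ to $e$ of length at most $5$.
   Context: Let $\mathbb O_C$ be the complexification of the real octonion algebra $\mathbb O$ (complex Cayley numbers), with complex-bilinear multiplication, the complex-linear extension $x\mapsto x^\diamond$ of octonion conjugation, and the conjugation $\overline{a+ib}=a-ib$ ($a,b\in\mathbb O$). $C_6$ is the 27-dimensional JB$^*$-algebra of $3\times3$ matrices $X=(x_{ij})$ over $\mathbb O_C$ which are hermitian in the sense $x_{ji}=x_{ij}^\diamond$, with Jordan product $X\circ Y=\frac12(XY+YX)$, involution $X^*=(\overline{x_{ij}})_{ij}$, and its unique JB$^*$-norm. It is a JB$^*$-triple with $\{x,y,z\}=(x\circ y^* )\circ z+x\circ(y^*\circ z)-(x\circ z)\circ y^*$. A tripotent is $e$ with $\{e,e,e\}=e$; it is unitary if $\{e,e,x\}=x$ for all $x$. A projection is $p$ with $p=p^*=p\circ p$; it is minimal if it is nonzero and $\{x:\{p,p,x\}=x\}=\mathbb Cp$. Tripotents $e,u$ are orthogonal if $\{e,u,x\}=0$ for all $x$. A complex unit is $\alpha\in\mathbb C$ with $|\alpha|=1$. Every unitary $u\in C_6$ can be written as $u=\alpha_1p_1+\alpha_2p_2+\alpha_3p_3$ with mutually orthogonal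 minimal projections $p_j$ and complex units $\alpha_j$, and $\operatorname{dt}u:=\alpha_1\alpha_2\alpha_3$ is well defined (the determinant of $u$). For tripotents $u,e$: $u\le_he$ iff $u=\{e,u,e\}$; $u\le_{hc}e$ iff $\alpha u\le_he$ for some complex unit $\alpha$. For $\kappa\in\{h,hc\}$: $u\sim_\kappa e$ iff $u\le_\kappa e$ and $e\le_\kappa u$; $u\le_{\kappa,t}e$ iff there are tripotents $e=v_0,\dots,v_k=u$ in $C_6$ with $v_j\le_\kappa v_{j-1}$ for all $j$; $u\sim_{\kappa,t}e$ iff $u\le_{\kappa,t}e$ and $e\le_{\kappa,t}u$. A chain of $\sim_\kappa$ of length $k$ from $u$ to $e$ consists of tripotents $u=w_0\sim_\kappa w_1\sim_\kappa\dots\sim_\kappa w_k=e$. *)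

theory Defs
  imports "HOL-Analysis.Analysis"
begin

text \<open>
  Octonions with coefficients in a commutative ring: an element is
  \<open>\<Sum>k. cf\<^sub>k e\<^sub>k\<close> with \<open>e\<^sub>0 = 1\<close>, \<open>e\<^sub>k\<^sup>2 = -1\<close> for \<open>k = 1, \<dots>, 7\<close>, and
  \<open>e\<^sub>n e\<^sub>n\<^sub>+\<^sub>1 = e\<^sub>n\<^sub>+\<^sub>3 = - e\<^sub>n\<^sub>+\<^sub>1 e\<^sub>n\<close> (and cyclically), indices in \<open>{1, \<dots>, 7}\<close> modulo 7.
  The type \<open>real octonion\<close> is the algebra of Cayley numbers; \<open>complex octonion\<close>, having the
  same structure constants, is its complexification (see \<open>complexification_*\<close> below).
\<close>

datatype 'a octonion =
  Octonion (cf0: 'a) (cf1: 'a) (cf2: 'a) (cf3: 'a) (cf4: 'a) (cf5: 'a) (cf6: 'a) (cf7: 'a)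

instantiation octonion :: (ab_group_add) ab_group_add
begin

definition zero_octonion :: "'a octonion" where
  "0 = Octonion 0 0 0 0 0 0 0 0"

definition plus_octonion :: "'a octonion \<Rightarrow> 'a octonion \<Rightarrow> 'a octonion" where
  "x + y = Octonion (cf0 x + cf0 y) (cf1 x + cf1 y) (cf2 x + cf2 y) (cf3 x + cf3 y)
    (cf4 x + cf4 y) (cf5 x + cf5 y) (cf6 x + cf6 y) (cf7 x + cf7 y)"

definition minus_octonion :: "'a octonion \<Rightarrow> 'a octonion \<Rightarrow> 'a octonion" where
  "x - y = Octonion (cf0 x - cf0 y) (cf1 x - cf1 y) (cf2 x - cf2 y) (cf3 x - cf3 y)
    (cf4 x - cf4 y) (cf5 x - cf5 y) (cf6 x - cf6 y) (cf7 x - cf7 y)"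

definition uminus_octonion :: "'a octonion \<Rightarrow> 'a octonion" where
  "- x = Octonion (- cf0 x) (- cf1 x) (- cf2 x) (- cf3 x)
    (- cf4 x) (- cf5 x) (- cf6 x) (- cf7 x)"

instance
  by standard (simp_all add: zero_octonion_def plus_octonion_def minus_octonion_def
      uminus_octonion_def octonion.expand algebra_simps)

end

instantiation octonion :: (comm_ring) times
begin

definition times_octonion :: "'a octonion \<Rightarrow> 'a octonion \<Rightarrow> 'a octonion" where
  "x * y = Octonion
      (cf0 x * cf0 y - cf1 x * cf1 y - cf2 x * cf2 y - cf3 x * cf3 y - cf4 x * cf4 y - cf5 x * cf5 y - cf6 x * cf6 y - cf7 x * cf7 y)
      (cf0 x * cf1 y + cf1 x * cf0 y + cf2 x * cf4 y + cf3 x * cf7 y - cf4 x * cf2 y + cf5 x * cf6 y - cf6 x * cf5 y - cf7 x * cf3 y)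
      (cf0 x * cf2 y - cf1 x * cf4 y + cf2 x * cf0 y + cf3 x * cf5 y + cf4 x * cf1 y - cf5 x * cf3 y + cf6 x * cf7 y - cf7 x * cf6 y)
      (cf0 x * cf3 y - cf1 x * cf7 y - cf2 x * cf5 y + cf3 x * cf0 y + cf4 x * cf6 y + cf5 x * cf2 y - cf6 x * cf4 y + cf7 x * cf1 y)
      (cf0 x * cf4 y + cf1 x * cf2 y - cf2 x * cf1 y - cf3 x * cf6 y + cf4 x * cf0 y + cf5 x * cf7 y + cf6 x * cf3 y - cf7 x * cf5 y)
      (cf0 x * cf5 y - cf1 x * cf6 y + cf2 x * cf3 y - cf3 x * cf2 y - cf4 x * cf7 y + cf5 x * cf0 y + cf6 x * cf1 y + cf7 x * cf4 y)
      (cf0 x * cf6 y + cf1 x * cf5 y - cf2 x * cf7 y + cf3 x * cf4 y - cf4 x * cf3 y - cf5 x * cf1 y + cf6 x * cf0 y + cf7 x * cf2 y)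
      (cf0 x * cf7 y + cf1 x * cf3 y + cf2 x * cf6 y - cf3 x * cf1 y + cf4 x * cf5 y - cf5 x * cf4 y - cf6 x * cf2 y + cf7 x * cf0 y)"

instance ..

end

instantiation octonion :: ("{zero, one}") one
begin

definition one_octonion :: "'a octonion" where
  "1 = Octonion 1 0 0 0 0 0 0 0"

instance ..

end

text \<open>
  On \<open>real octonion\<close> this is octonion conjugation, on \<open>complex octonion\<close> its
  complex-linear extension \<open>x \<mapsto> x\<^sup>\<diamond>\<close>.
\<close>

definition dia :: "'a::ab_group_add octonion \<Rightarrow> 'a octonion" where
  "dia x = Octonion (cf0 x) (- cf1 x) (- cf2 x) (- cf3 x) (- cf4 x) (- cf5 x) (- cf6 x) (- cf7 x)"

definition bar :: "complex octonion \<Rightarrow> complex octonion" where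
  "bar x = map_octonion cnj x"

definition octonion_scale :: "'a::times \<Rightarrow> 'a octonion \<Rightarrow> 'a octonion" where
  "octonion_scale \<alpha> x = map_octonion (\<lambda>c. \<alpha> * c) x"

text \<open>
  Checks of the encoding: the algebra is unital, and its quadratic norm form, which is positive
  definite over the reals, is multiplicative; the complex octonions are
  \<open>a + \<i> b\<close> with \<open>a\<close>, \<open>b\<close> real octonions.
\<close>

lemma octonion_one_mult:
  fixes x :: "'a::comm_ring_1 octonion"
  shows "1 * x = x" "x * 1 = x"
  by (simp_all add: one_octonion_def times_octonion_def octonion.expand)

definition octonion_norm2 :: "'a::comm_ring_1 octonion \<Rightarrow> 'a" where
  "octonion_norm2 x = (cf0 x)\<^sup>2 + (cf1 x)\<^sup>2 + (cf2 x)\<^sup>2 + (cf3 x)\<^sup>2 + (cf4 x)\<^sup>2 + (cf5 x)\<^sup>2 + (cf6 x)\<^sup>2 + (cf7 x)\<^sup>2"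

lemma octonion_mult_dia:
  "x * dia x = Octonion (octonion_norm2 x) 0 0 0 0 0 0 0"
  by (simp add: times_octonion_def dia_def octonion_norm2_def power2_eq_square algebra_simps)

lemma octonion_norm2_mult:
  "octonion_norm2 (x * y) = octonion_norm2 x * octonion_norm2 y"
  by (simp add: times_octonion_def octonion_norm2_def power2_eq_square algebra_simps)

lemma octonion_mult_bilinear:
  fixes x y z :: "'a::comm_ring octonion"
  shows "(x + y) * z = x * z + y * z" "x * (y + z) = x * y + x * z"
    "octonion_scale c x * y = octonion_scale c (x * y)"
    "x * octonion_scale c y = octonion_scale c (x * y)"
  by (simp_all add: times_octonion_def plus_octonion_def octonion_scale_def octonion.map_sel
      algebra_simps)

abbreviation complexify :: "real octonion \<Rightarrow> complex octonion" where
  "complexify \<equiv> map_octonion complex_of_real"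

lemma complexification_mult: "complexify (a * b) = complexify a * complexify b"
  by (simp add: times_octonion_def octonion.map_sel)

lemma complexification_dia: "complexify (dia a) = dia (complexify a)"
  by (simp add: dia_def octonion.map_sel)

lemma complexification_decomp:
  "\<exists>!(a, b). x = complexify a + octonion_scale \<i> (complexify b)"
proof -
  have "x = complexify a + octonion_scale \<i> (complexify b) \<longleftrightarrow>
      (a, b) = (map_octonion Re x, map_octonion Im x)" for a b
    by (cases x; cases a; cases b)
      (auto simp: plus_octonion_def octonion_scale_def complex_eq_iff)
  then show ?thesis
    by auto
qed

lemma complexification_bar:
  "bar (complexify a + octonion_scale \<i> (complexify b)) =
    complexify a - octonion_scale \<i> (complexify b)"
  by (simp add: bar_def plus_octonion_def minus_octonion_def octonion_scale_def octonion.map_sel)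


type_synonym octmat = "complex octonion ^ 3 ^ 3"

text \<open>
  The library product \<open>**\<close> needs associative entries, so the row-by-column product is
  written out.
\<close>

definition octmat_mult :: "octmat \<Rightarrow> octmat \<Rightarrow> octmat" where
  "octmat_mult X Y = (\<chi> i j. \<Sum>k\<in>UNIV. X $ i $ k * Y $ k $ j)"

definition octmat_scale :: "complex \<Rightarrow> octmat \<Rightarrow> octmat" where
  "octmat_scale \<alpha> X = (\<chi> i j. octonion_scale \<alpha> (X $ i $ j))"

definition octmat_star :: "octmat \<Rightarrow> octmat" where
  "octmat_star X = (\<chi> i j. bar (X $ i $ j))"

definition jordan :: "octmat \<Rightarrow> octmat \<Rightarrow> octmat" where
  "jordan X Y = octmat_scale (1/2) (octmat_mult X Y + octmat_mult Y X)"

definition C6 :: "octmat set" where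
  "C6 = {X. \<forall>i j. X $ j $ i = dia (X $ i $ j)}"

definition triple :: "octmat \<Rightarrow> octmat \<Rightarrow> octmat \<Rightarrow> octmat" where
  "triple x y z = jordan (jordan x (octmat_star y)) z + jordan x (jordan (octmat_star y) z)
     - jordan (jordan x z) (octmat_star y)"

definition tripotent :: "octmat \<Rightarrow> bool" where
  "tripotent e \<longleftrightarrow> e \<in> C6 \<and> triple e e e = e"

definition unitary :: "octmat \<Rightarrow> bool" where
  "unitary e \<longleftrightarrow> tripotent e \<and> (\<forall>x\<in>C6. triple e e x = x)"

definition projection :: "octmat \<Rightarrow> bool" where
  "projection p \<longleftrightarrow> p \<in> C6 \<and> p = octmat_star p \<and> p = jordan p p"

definition minimal_projection :: "octmat \<Rightarrow> bool" where
  "minimal_projection p \<longleftrightarrow>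
     projection p \<and> p \<noteq> 0 \<and> {x \<in> C6. triple p p x = x} = range (\<lambda>\<alpha>. octmat_scale \<alpha> p)"

definition orthogonal_tripotents :: "octmat \<Rightarrow> octmat \<Rightarrow> bool" where
  "orthogonal_tripotents e u \<longleftrightarrow>
     tripotent e \<and> tripotent u \<and> (\<forall>x\<in>C6. triple e u x = 0)"

definition spectral_decomposition :: "octmat \<Rightarrow> (3 \<Rightarrow> complex) \<Rightarrow> (3 \<Rightarrow> octmat) \<Rightarrow> bool" where
  "spectral_decomposition u \<alpha> p \<longleftrightarrow>
     (\<forall>j. cmod (\<alpha> j) = 1) \<and> (\<forall>j. minimal_projection (p j)) \<and>
     (\<forall>j k. j \<noteq> k \<longrightarrow> orthogonal_tripotents (p j) (p k)) \<and>
     u = (\<Sum>j\<in>UNIV. octmat_scale (\<alpha> j) (p j))"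

text \<open>Meaningful for unitary \<open>u\<close> only.\<close>

definition dt :: "octmat \<Rightarrow> complex" where
  "dt u = (THE d. \<exists>\<alpha> p. spectral_decomposition u \<alpha> p \<and> d = (\<Prod>j\<in>UNIV. \<alpha> j))"

definition le_h :: "octmat \<Rightarrow> octmat \<Rightarrow> bool" where
  "le_h u e \<longleftrightarrow> tripotent u \<and> tripotent e \<and> u = triple e u e"

definition le_hc :: "octmat \<Rightarrow> octmat \<Rightarrow> bool" where
  "le_hc u e \<longleftrightarrow> tripotent u \<and> tripotent e \<and> (\<exists>\<alpha>. cmod \<alpha> = 1 \<and> le_h (octmat_scale \<alpha> u) e)"

text \<open>The next four notions take \<open>le\<close> to be \<^const>\<open>le_h\<close> or \<^const>\<open>le_hc\<close>.\<close>

definition sim :: "(octmat \<Rightarrow> octmat \<Rightarrow> bool) \<Rightarrow> octmat \<Rightarrow> octmat \<Rightarrow> bool" where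
  "sim le u e \<longleftrightarrow> le u e \<and> le e u"

definition le_t :: "(octmat \<Rightarrow> octmat \<Rightarrow> bool) \<Rightarrow> octmat \<Rightarrow> octmat \<Rightarrow> bool" where
  "le_t le u e \<longleftrightarrow>
     (\<exists>(k::nat) v. v 0 = e \<and> v k = u \<and> (\<forall>j\<le>k. tripotent (v j)) \<and>
        (\<forall>j\<in>{1..k}. le (v j) (v (j - 1))))"

definition sim_t :: "(octmat \<Rightarrow> octmat \<Rightarrow> bool) \<Rightarrow> octmat \<Rightarrow> octmat \<Rightarrow> bool" where
  "sim_t le u e \<longleftrightarrow> le_t le u e \<and> le_t le e u"

definition sim_chain ::
    "(octmat \<Rightarrow> octmat \<Rightarrow> bool) \<Rightarrow> nat \<Rightarrow> octmat \<Rightarrow> octmat \<Rightarrow> bool" where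
  "sim_chain le k u e \<longleftrightarrow>
     (\<exists>w. w 0 = u \<and> w k = e \<and> (\<forall>j\<le>k. tripotent (w j)) \<and>
        (\<forall>j<k. sim le (w j) (w (Suc j))))"

end

theory Submission
  imports Defs
begin

text \<open>
  In coordinates, \<open>C\<^sub>6\<close> is the complexified Albert algebra with cubic norm \<open>N\<close>, trace form
  \<open>T\<close> and adjoint \<open>x\<^sup>#\<close>, and \<open>{x,y,x} = U\<^sub>x y\<^sup>*\<close> with \<open>U\<^sub>x y = T(x,y) x - x\<^sup># \<times> y\<close>. The
  identity \<open>x\<^sup>#\<^sup># = N(x) x\<close> and its linearisations yield \<open>N(U\<^sub>x y) = N(x)\<^sup>2 N(y)\<close> and, for
  invertible \<open>x\<close>, the fundamental formula; hence \<open>U\<^sub>r\<close> is a triple automorphism for unitary \<open>r\<close>,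
  and \<open>u = U\<^sub>v u\<^sup>*\<close> with \<open>|N(u)| = 1\<close> forces \<open>N(v)\<^sup>2 = N(u)\<^sup>2\<close>.

  A hermitian element has a real eigenvalue, whose eigenprojection is moved to a diagonal matrix
  unit by an explicit reflection; a second reflection diagonalises the remaining block. The real
  and imaginary parts of a unitary operator-commute, so a unitary can be diagonalised as well, and
  \<open>dt u = N(u)\<close>.

  Applying \<open>U\<^sub>r\<close> with \<open>r\<close> a square root of \<open>e\<close>, one may take \<open>e = 1\<close> and \<open>u = diag(a,b,c)\<close>.
  If \<open>abc = 1\<close>, then \<open>u\<close> is linked to \<open>diag(a,a\<^sup>-\<^sup>1,1)\<close> and this to \<open>1\<close>, in two steps each,
  through elements that exchange two diagonal entries. The sign in \<open>N(u) = - N(e)\<close> costs the step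
  \<open>u \<sim> -u\<close>, and in the case of \<open>\<sim>\<^sub>h\<^sub>c\<close> a cube root of unit modulus normalises \<open>N(u)\<close>, again in
  one step.
\<close>

section \<open>The octonions as a composition algebra\<close>

lemma octonion_eq_iff:
  "x = y \<longleftrightarrow> cf0 x = cf0 y \<and> cf1 x = cf1 y \<and> cf2 x = cf2 y \<and> cf3 x = cf3 y \<and>
     cf4 x = cf4 y \<and> cf5 x = cf5 y \<and> cf6 x = cf6 y \<and> cf7 x = cf7 y"
  by (metis octonion.expand)

lemma cf_plus [simp]:
  "cf0 (x + y) = cf0 x + cf0 y" "cf1 (x + y) = cf1 x + cf1 y" "cf2 (x + y) = cf2 x + cf2 y"
  "cf3 (x + y) = cf3 x + cf3 y" "cf4 (x + y) = cf4 x + cf4 y" "cf5 (x + y) = cf5 x + cf5 y"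
  "cf6 (x + y) = cf6 x + cf6 y" "cf7 (x + y) = cf7 x + cf7 y"
  by (simp_all add: plus_octonion_def)

lemma cf_minus [simp]:
  "cf0 (x - y) = cf0 x - cf0 y" "cf1 (x - y) = cf1 x - cf1 y" "cf2 (x - y) = cf2 x - cf2 y"
  "cf3 (x - y) = cf3 x - cf3 y" "cf4 (x - y) = cf4 x - cf4 y" "cf5 (x - y) = cf5 x - cf5 y"
  "cf6 (x - y) = cf6 x - cf6 y" "cf7 (x - y) = cf7 x - cf7 y"
  by (simp_all add: minus_octonion_def)

lemma cf_uminus [simp]:
  "cf0 (- x) = - cf0 x" "cf1 (- x) = - cf1 x" "cf2 (- x) = - cf2 x" "cf3 (- x) = - cf3 x"
  "cf4 (- x) = - cf4 x" "cf5 (- x) = - cf5 x" "cf6 (- x) = - cf6 x" "cf7 (- x) = - cf7 x"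
  by (simp_all add: uminus_octonion_def)

lemma cf_zero [simp]:
  "cf0 0 = 0" "cf1 0 = 0" "cf2 0 = 0" "cf3 0 = 0" "cf4 0 = 0" "cf5 0 = 0" "cf6 0 = 0" "cf7 0 = 0"
  by (simp_all add: zero_octonion_def)

lemma cf_one [simp]:
  "cf0 1 = 1" "cf1 1 = 0" "cf2 1 = 0" "cf3 1 = 0" "cf4 1 = 0" "cf5 1 = 0" "cf6 1 = 0" "cf7 1 = 0"
  by (simp_all add: one_octonion_def)

lemma cf_dia [simp]:
  "cf0 (dia x) = cf0 x" "cf1 (dia x) = - cf1 x" "cf2 (dia x) = - cf2 x" "cf3 (dia x) = - cf3 x"
  "cf4 (dia x) = - cf4 x" "cf5 (dia x) = - cf5 x" "cf6 (dia x) = - cf6 x" "cf7 (dia x) = - cf7 x"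
  by (simp_all add: dia_def)

lemma cf_scale [simp]:
  "cf0 (octonion_scale c x) = c * cf0 x" "cf1 (octonion_scale c x) = c * cf1 x"
  "cf2 (octonion_scale c x) = c * cf2 x" "cf3 (octonion_scale c x) = c * cf3 x"
  "cf4 (octonion_scale c x) = c * cf4 x" "cf5 (octonion_scale c x) = c * cf5 x"
  "cf6 (octonion_scale c x) = c * cf6 x" "cf7 (octonion_scale c x) = c * cf7 x"
  by (simp_all add: octonion_scale_def octonion.map_sel)

lemma cf_bar [simp]:
  "cf0 (bar x) = cnj (cf0 x)" "cf1 (bar x) = cnj (cf1 x)" "cf2 (bar x) = cnj (cf2 x)"
  "cf3 (bar x) = cnj (cf3 x)" "cf4 (bar x) = cnj (cf4 x)" "cf5 (bar x) = cnj (cf5 x)"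
  "cf6 (bar x) = cnj (cf6 x)" "cf7 (bar x) = cnj (cf7 x)"
  by (simp_all add: bar_def octonion.map_sel)

text \<open>The polar form of \<open>octonion_norm2\<close>, hence the factor 2.\<close>

definition octonion_ip :: "'a::comm_ring_1 octonion \<Rightarrow> 'a octonion \<Rightarrow> 'a" where
  "octonion_ip x y = 2 * (cf0 x * cf0 y + cf1 x * cf1 y + cf2 x * cf2 y + cf3 x * cf3 y +
     cf4 x * cf4 y + cf5 x * cf5 y + cf6 x * cf6 y + cf7 x * cf7 y)"

lemma octonion_norm2_add:
  "octonion_norm2 (x + y) = octonion_norm2 x + octonion_ip x y + octonion_norm2 y"
  by (simp add: octonion_norm2_def octonion_ip_def power2_eq_square algebra_simps)

lemma octonion_norm2_diff:
  "octonion_norm2 (x - y) = octonion_norm2 x - octonion_ip x y + octonion_norm2 y"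
  by (simp add: octonion_norm2_def octonion_ip_def power2_eq_square algebra_simps)

lemma octonion_norm2_scale: "octonion_norm2 (octonion_scale c x) = c\<^sup>2 * octonion_norm2 x"
  by (simp add: octonion_norm2_def power2_eq_square algebra_simps)

lemma octonion_norm2_dia: "octonion_norm2 (dia x) = octonion_norm2 x"
  by (simp add: octonion_norm2_def)

lemma octonion_ip_commute: "octonion_ip x y = octonion_ip y x"
  by (simp add: octonion_ip_def algebra_simps)

lemma octonion_ip_self: "octonion_ip x x = 2 * octonion_norm2 x"
  by (simp add: octonion_norm2_def octonion_ip_def power2_eq_square)

lemma octonion_ip_linear:
  "octonion_ip (x + y) z = octonion_ip x z + octonion_ip y z"
  "octonion_ip z (x + y) = octonion_ip z x + octonion_ip z y"
  "octonion_ip (x - y) z = octonion_ip x z - octonion_ip y z"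
  "octonion_ip z (x - y) = octonion_ip z x - octonion_ip z y"
  "octonion_ip (- x) z = - octonion_ip x z"
  "octonion_ip z (- x) = - octonion_ip z x"
  "octonion_ip (octonion_scale c x) z = c * octonion_ip x z"
  "octonion_ip z (octonion_scale c x) = c * octonion_ip z x"
  "octonion_ip 0 z = 0" "octonion_ip z 0 = 0"
  by (simp_all add: octonion_ip_def algebra_simps)

text \<open>Both sides are traces: \<open>octonion_ip (dia a) z\<close> is twice the scalar part of
  \<open>a * z\<close>. This cyclic trilinear form is the mixed term of the cubic norm
  \<open>nrm\<close>.\<close>

lemma octonion_ip_dia_cycle: "octonion_ip (dia (x * y)) z = octonion_ip (dia (y * z)) x"
  by (simp add: octonion_ip_def times_octonion_def algebra_simps)

lemma octonion_dia_mult: "dia (x * y) = dia y * dia x"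
  by (simp add: octonion_eq_iff times_octonion_def algebra_simps)

lemma octonion_left_alternative: "dia x * (x * y) = octonion_scale (octonion_norm2 x) y"
  by (simp add: octonion_eq_iff times_octonion_def octonion_norm2_def power2_eq_square
      algebra_simps)

lemma octonion_right_alternative: "(y * x) * dia x = octonion_scale (octonion_norm2 x) y"
  by (simp add: octonion_eq_iff times_octonion_def octonion_norm2_def power2_eq_square
      algebra_simps)

lemma octonion_ip_adjoint:
  "octonion_ip (x * y) z = octonion_ip x (z * dia y)"
  "octonion_ip (x * y) z = octonion_ip y (dia x * z)"
  by (simp_all add: octonion_ip_def times_octonion_def algebra_simps)

lemma octonion_ip_nondegenerate:
  fixes x y :: "complex octonion"
  assumes "\<And>z. octonion_ip x z = octonion_ip y z"
  shows "x = y"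
  using assms[of "Octonion 1 0 0 0 0 0 0 0"] assms[of "Octonion 0 1 0 0 0 0 0 0"]
    assms[of "Octonion 0 0 1 0 0 0 0 0"] assms[of "Octonion 0 0 0 1 0 0 0 0"]
    assms[of "Octonion 0 0 0 0 1 0 0 0"] assms[of "Octonion 0 0 0 0 0 1 0 0"]
    assms[of "Octonion 0 0 0 0 0 0 1 0"] assms[of "Octonion 0 0 0 0 0 0 0 1"]
  by (simp add: octonion_ip_def octonion_eq_iff)

lemma octonion_ip_mult_left: "octonion_ip (x * y) (x * w) = octonion_norm2 x * octonion_ip y w"
  using octonion_norm2_mult[of x "y + w"]
  by (simp add: octonion_mult_bilinear octonion_norm2_add octonion_norm2_mult distrib_left)

text \<open>Second polarisation of \<open>octonion_norm2_mult\<close>: the right factor was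
  polarised in \<open>octonion_ip_mult_left\<close>, now the left one.\<close>

lemma octonion_ip_composition:
  "octonion_ip (x * y) (z * w) + octonion_ip (x * w) (z * y) = octonion_ip x z * octonion_ip y w"
  using octonion_ip_mult_left[of "x + z" y w]
  by (simp add: octonion_mult_bilinear octonion_norm2_add octonion_ip_mult_left octonion_ip_linear
      octonion_ip_commute[of "z * y"] distrib_left distrib_right add.commute)

lemma dia_dia [simp]: "dia (dia x) = x"
  by (simp add: octonion_eq_iff)

text \<open>The middle Moufang identity \<open>(x y)(z x) = x (y z) x\<close>, with
  \<open>x a x\<close> written through the norm form. It is tested against an arbitrary
  \<open>w\<close>, where the composition law replaces associativity.\<close>

lemma octonion_moufang:
  fixes x y z :: "complex octonion"
  shows "(x * y) * (z * x) =
     octonion_scale (octonion_ip (dia (y * z)) x) x - octonion_scale (octonion_norm2 x) (dia (y *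
         z))"
proof (rule octonion_ip_nondegenerate)
  fix w
  have "octonion_ip ((x * y) * (z * x)) w = octonion_ip (x * y) (w * (dia x * dia z))"
    by (simp add: octonion_ip_adjoint(1)[of "x * y"] octonion_dia_mult)
  also have "\<dots> = octonion_ip x w * octonion_ip y (dia x * dia z) - octonion_ip (x * (dia x * dia
      z)) (w * y)"
    using octonion_ip_composition[of x y w "dia x * dia z"] by (simp add: algebra_simps)
  also have "x * (dia x * dia z) = octonion_scale (octonion_norm2 x) (dia z)"
    using octonion_left_alternative[of "dia x" "dia z"] by (simp add: octonion_norm2_dia)
  also have "octonion_ip y (dia x * dia z) = octonion_ip (dia (y * z)) x"
    by (metis octonion_dia_mult octonion_ip_commute octonion_ip_dia_cycle)
  also have "octonion_ip (octonion_scale (octonion_norm2 x) (dia z)) (w * y) =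
      octonion_norm2 x * octonion_ip (dia (y * z)) w"
    by (metis octonion_dia_mult octonion_ip_adjoint(1) octonion_ip_commute octonion_ip_linear(7))
  finally show "octonion_ip ((x * y) * (z * x)) w = octonion_ip
      (octonion_scale (octonion_ip (dia (y * z)) x) x - octonion_scale (octonion_norm2 x) (dia (y
          * z))) w"
    by (simp add: octonion_ip_linear algebra_simps)
qed

section \<open>The cubic norm structure of the Albert algebra\<close>

text \<open>\<open>o1\<close>, \<open>o2\<close>, \<open>o3\<close> stand for the matrix entries
  (2,3), (3,1), (1,2), see \<open>albert_mat\<close>; with this choice all formulas are invariant
  under cyclic shifts of the indices.\<close>

datatype albert =
  Albert (d1: complex) (d2: complex) (d3: complex)
    (o1: "complex octonion") (o2: "complex octonion") (o3: "complex octonion")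

lemma albert_eq_iff:
  "x = y \<longleftrightarrow> d1 x = d1 y \<and> d2 x = d2 y \<and> d3 x = d3 y \<and> o1 x = o1 y \<and> o2 x = o2 y \<and> o3 x = o3 y"
  by (metis albert.expand)

instantiation albert :: ab_group_add
begin

definition zero_albert :: albert where
  "0 = Albert 0 0 0 0 0 0"

definition plus_albert :: "albert \<Rightarrow> albert \<Rightarrow> albert" where
  "x + y = Albert (d1 x + d1 y) (d2 x + d2 y) (d3 x + d3 y) (o1 x + o1 y) (o2 x + o2 y) (o3 x + o3
      y)"

definition minus_albert :: "albert \<Rightarrow> albert \<Rightarrow> albert" where
  "x - y = Albert (d1 x - d1 y) (d2 x - d2 y) (d3 x - d3 y) (o1 x - o1 y) (o2 x - o2 y) (o3 x - o3
      y)"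

definition uminus_albert :: "albert \<Rightarrow> albert" where
  "- x = Albert (- d1 x) (- d2 x) (- d3 x) (- o1 x) (- o2 x) (- o3 x)"

instance
  by standard (simp_all add: zero_albert_def plus_albert_def minus_albert_def uminus_albert_def
      albert_eq_iff algebra_simps)

end

instantiation albert :: one
begin

definition one_albert :: albert where
  "1 = Albert 1 1 1 0 0 0"

instance ..

end

definition albert_scale :: "complex \<Rightarrow> albert \<Rightarrow> albert" (infixr "*\<^sub>A" 75) where
  "c *\<^sub>A x = Albert (c * d1 x) (c * d2 x) (c * d3 x)
     (octonion_scale c (o1 x)) (octonion_scale c (o2 x)) (octonion_scale c (o3 x))"

lemma albert_sel [simp]:
  "d1 (x + y) = d1 x + d1 y" "d2 (x + y) = d2 x + d2 y" "d3 (x + y) = d3 x + d3 y"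
  "o1 (x + y) = o1 x + o1 y" "o2 (x + y) = o2 x + o2 y" "o3 (x + y) = o3 x + o3 y"
  "d1 (x - y) = d1 x - d1 y" "d2 (x - y) = d2 x - d2 y" "d3 (x - y) = d3 x - d3 y"
  "o1 (x - y) = o1 x - o1 y" "o2 (x - y) = o2 x - o2 y" "o3 (x - y) = o3 x - o3 y"
  "d1 (- x) = - d1 x" "d2 (- x) = - d2 x" "d3 (- x) = - d3 x"
  "o1 (- x) = - o1 x" "o2 (- x) = - o2 x" "o3 (- x) = - o3 x"
  "d1 0 = 0" "d2 0 = 0" "d3 0 = 0" "o1 0 = 0" "o2 0 = 0" "o3 0 = 0"
  "d1 1 = 1" "d2 1 = 1" "d3 1 = 1" "o1 1 = 0" "o2 1 = 0" "o3 1 = 0"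
  "d1 (c *\<^sub>A x) = c * d1 x" "d2 (c *\<^sub>A x) = c * d2 x" "d3 (c *\<^sub>A x) = c * d3 x"
  "o1 (c *\<^sub>A x) = octonion_scale c (o1 x)" "o2 (c *\<^sub>A x) = octonion_scale c (o2 x)"
  "o3 (c *\<^sub>A x) = octonion_scale c (o3 x)"
  by (simp_all add: plus_albert_def minus_albert_def uminus_albert_def zero_albert_def
      one_albert_def albert_scale_def)

interpretation albert: vector_space albert_scale
  by standard (simp_all add: albert_eq_iff octonion_eq_iff algebra_simps)

definition tr :: "albert \<Rightarrow> albert \<Rightarrow> complex" where
  "tr x y = d1 x * d1 y + d2 x * d2 y + d3 x * d3 y +
     octonion_ip (o1 x) (o1 y) + octonion_ip (o2 x) (o2 y) + octonion_ip (o3 x) (o3 y)"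

text \<open>Freudenthal's determinant of a hermitian octonion matrix.\<close>

definition nrm :: "albert \<Rightarrow> complex" where
  "nrm x = d1 x * d2 x * d3 x - d1 x * octonion_norm2 (o1 x) - d2 x * octonion_norm2 (o2 x) -
     d3 x * octonion_norm2 (o3 x) + octonion_ip (dia (o1 x * o2 x)) (o3 x)"

definition adj :: "albert \<Rightarrow> albert" where
  "adj x = Albert (d2 x * d3 x - octonion_norm2 (o1 x)) (d3 x * d1 x - octonion_norm2 (o2 x))
     (d1 x * d2 x - octonion_norm2 (o3 x))
     (dia (o2 x * o3 x) - octonion_scale (d1 x) (o1 x))
     (dia (o3 x * o1 x) - octonion_scale (d2 x) (o2 x))
     (dia (o1 x * o2 x) - octonion_scale (d3 x) (o3 x))"

text \<open>The polarisation of \<open>adj\<close>, without a factor 1/2.\<close>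

definition cross :: "albert \<Rightarrow> albert \<Rightarrow> albert" where
  "cross x y = Albert
     (d2 x * d3 y + d2 y * d3 x - octonion_ip (o1 x) (o1 y))
     (d3 x * d1 y + d3 y * d1 x - octonion_ip (o2 x) (o2 y))
     (d1 x * d2 y + d1 y * d2 x - octonion_ip (o3 x) (o3 y))
     (dia (o2 x * o3 y) + dia (o2 y * o3 x) - octonion_scale (d1 x) (o1 y) - octonion_scale (d1 y)
         (o1 x))
     (dia (o3 x * o1 y) + dia (o3 y * o1 x) - octonion_scale (d2 x) (o2 y) - octonion_scale (d2 y)
         (o2 x))
     (dia (o1 x * o2 y) + dia (o1 y * o2 x) - octonion_scale (d3 x) (o3 y) - octonion_scale (d3 y)
         (o3 x))"

definition Uop :: "albert \<Rightarrow> albert \<Rightarrow> albert" where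
  "Uop x y = tr x y *\<^sub>A x - cross (adj x) y"

definition star :: "albert \<Rightarrow> albert" where
  "star x = Albert (cnj (d1 x)) (cnj (d2 x)) (cnj (d3 x)) (bar (o1 x)) (bar (o2 x)) (bar (o3 x))"

lemma dia_linear:
  fixes x y :: "'a::comm_ring_1 octonion"
  shows "dia (x + y) = dia x + dia y" "dia (x - y) = dia x - dia y" "dia (- x) = - dia x"
  "dia (octonion_scale c x) = octonion_scale c (dia x)" "dia (0::'a octonion) = 0"
  "dia (1::'a octonion) = 1"
  by (simp_all add: octonion_eq_iff)

lemma octonion_scale_linear:
  fixes x y :: "complex octonion"
  shows "octonion_scale c (x + y) = octonion_scale c x + octonion_scale c y"
    "octonion_scale c (x - y) = octonion_scale c x - octonion_scale c y"
    "octonion_scale (c + d) x = octonion_scale c x + octonion_scale d x"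
    "octonion_scale (c - d) x = octonion_scale c x - octonion_scale d x"
    "octonion_scale c (octonion_scale d x) = octonion_scale (c * d) x"
    "octonion_scale c (- x) = - octonion_scale c x" "octonion_scale (- c) x = - octonion_scale c x"
    "octonion_scale 0 x = 0" "octonion_scale 1 x = x" "octonion_scale c 0 = (0::complex octonion)"
  by (simp_all add: octonion_eq_iff algebra_simps)

lemma octonion_mult_linear:
  fixes x y z :: "complex octonion"
  shows "(x - y) * z = x * z - y * z" "x * (y - z) = x * y - x * z" "(- x) * y = - (x * y)"
    "x * (- y) = - (x * y)" "0 * x = 0" "x * 0 = 0"
  by (simp_all add: octonion_eq_iff times_octonion_def algebra_simps)

lemmas octonion_linear = dia_linear octonion_scale_linear octonion_mult_linear
    octonion_mult_bilinear
  octonion_ip_linear octonion_one_mult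

lemma tr_commute: "tr x y = tr y x"
  by (simp add: tr_def octonion_ip_commute mult.commute)

lemma tr_linear:
  "tr (x + y) z = tr x z + tr y z" "tr z (x + y) = tr z x + tr z y"
  "tr (x - y) z = tr x z - tr y z" "tr z (x - y) = tr z x - tr z y"
  "tr (- x) z = - tr x z" "tr z (- x) = - tr z x"
  "tr (c *\<^sub>A x) z = c * tr x z" "tr z (c *\<^sub>A x) = c * tr z x"
  "tr 0 z = 0" "tr z 0 = 0"
  by (simp_all add: tr_def octonion_linear algebra_simps)

text \<open>Reduces vector identities to scalar ones, which is how most identities below are checked.\<close>

lemma tr_nondegenerate:
  assumes "\<And>z. tr x z = tr y z"
  shows "x = y"
proof -
  have "o1 x = o1 y" "o2 x = o2 y" "o3 x = o3 y"
    using assms[of "Albert 0 0 0 _ 0 0"] assms[of "Albert 0 0 0 0 _ 0"] assms[of "Albert 0 0 0 0 0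
        _"]
    by (auto intro: octonion_ip_nondegenerate simp: tr_def octonion_linear)
  then show ?thesis
    using assms[of "Albert 1 0 0 0 0 0"] assms[of "Albert 0 1 0 0 0 0"] assms[of "Albert 0 0 1 0 0
        0"]
    by (simp add: tr_def albert_eq_iff octonion_linear)
qed

lemma cross_commute: "cross x y = cross y x"
  by (simp add: cross_def octonion_ip_commute add.commute diff_diff_eq)

lemma cross_linear:
  "cross (x + y) z = cross x z + cross y z" "cross z (x + y) = cross z x + cross z y"
  "cross (x - y) z = cross x z - cross y z" "cross z (x - y) = cross z x - cross z y"
  "cross (- x) z = - cross x z" "cross z (- x) = - cross z x"
  "cross (c *\<^sub>A x) z = c *\<^sub>A cross x z" "cross z (c *\<^sub>A x) = c *\<^sub>A cross z x"
  "cross 0 z = 0" "cross z 0 = 0"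
  by (simp_all add: cross_def albert_eq_iff octonion_linear algebra_simps)

lemma adj_add: "adj (x + y) = adj x + cross x y + adj y"
  by (simp add: cross_def adj_def albert_eq_iff octonion_linear octonion_norm2_add algebra_simps)

lemma adj_scale: "adj (c *\<^sub>A x) = c\<^sup>2 *\<^sub>A adj x"
  by (simp add: adj_def albert_eq_iff octonion_linear octonion_norm2_scale power2_eq_square
      algebra_simps)

lemma cross_self: "cross x x = 2 *\<^sub>A adj x"
  by (simp add: cross_def adj_def albert_eq_iff octonion_ip_self octonion_eq_iff)

lemma nrm_scale: "nrm (c *\<^sub>A x) = c ^ 3 * nrm x"
  by (simp add: nrm_def octonion_norm2_scale octonion_linear power3_eq_cube power2_eq_square
      algebra_simps)

text \<open>The Taylor expansion of the cubic form: \<open>adj\<close> is the gradient of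
  \<open>nrm\<close> for the trace form. Together with \<open>adj_adj\<close> it is the core of the
  cubic norm structure.\<close>

lemma nrm_add: "nrm (x + y) = nrm x + tr (adj x) y + tr x (adj y) + nrm y"
  using octonion_ip_dia_cycle[of "o2 x" "o3 x" "o1 y"] octonion_ip_dia_cycle[of "o3 x" "o1 x" "o2
      y"]
    octonion_ip_dia_cycle[of "o1 y" "o2 x" "o3 x"] octonion_ip_dia_cycle[of "o1 x" "o2 y" "o3 x"]
    octonion_ip_dia_cycle[of "o2 y" "o3 y" "o1 x"] octonion_ip_dia_cycle[of "o3 y" "o1 y" "o2 x"]
    octonion_ip_dia_cycle[of "o1 x" "o2 y" "o3 y"] octonion_ip_dia_cycle[of "o1 y" "o2 x" "o3 y"]
    octonion_ip_commute
  by (simp add: nrm_def tr_def adj_def octonion_norm2_add octonion_linear octonion_ip_commute[of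
      "o1 x"]
    octonion_ip_commute[of "o2 x"] octonion_ip_commute[of "o3 x"] algebra_simps)

text \<open>Euler's identity for a cubic form, read off from
  \<open>nrm (x + x) = 8 * nrm x\<close>.\<close>

lemma tr_adj_self: "tr (adj x) x = 3 * nrm x"
proof -
  have "x + x = 2 *\<^sub>A x"
    by (simp add: albert_eq_iff octonion_eq_iff)
  then show ?thesis
    using nrm_add[of x x] nrm_scale[of 2 x] tr_commute[of x "adj x"] by simp
qed

text \<open>The mixed term of \<open>nrm (x + y + z)\<close> does not depend on the order of the
  summands.\<close>

lemma tr_cross_cycle: "tr (cross x y) z = tr (cross y z) x"
proof -
  have "nrm (x + y + z) = nrm (y + z + x)"
    by (simp add: add.commute add.left_commute)
  then show ?thesis
    by (simp add: nrm_add adj_add tr_linear tr_commute[of _ "adj x"] tr_commute[of _ "adj y"]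
        tr_commute[of _ "adj z"])
qed

lemma octonion_norm2_dia_mult: "octonion_norm2 (dia (x * y)) = octonion_norm2 x * octonion_norm2 y"
  by (simp add: octonion_norm2_dia octonion_norm2_mult)

text \<open>One off-diagonal entry of \<open>adj_adj\<close>, for generic letters so that cyclic
  instances give all three. The Moufang identity treats the product of two products (fact 1), the
  alternative laws the mixed terms (facts 2 and 3).\<close>

lemma adj_adj_off_diagonal:
  fixes x y z :: "complex octonion"
  shows "dia ((dia (z * x) - octonion_scale b y) * (dia (x * y) - octonion_scale c z)) -
      octonion_scale (b * c - octonion_norm2 x) (dia (y * z) - octonion_scale a x) =
    octonion_scale (a * b * c - a * octonion_norm2 x - b * octonion_norm2 y - c * octonion_norm2 z +
      octonion_ip (dia (x * y)) z) x"
proof -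
  have 1: "dia (dia (z * x) * dia (x * y)) =
      octonion_scale (octonion_ip (dia (x * y)) z) x - octonion_scale (octonion_norm2 x) (dia (y *
          z))"
    using octonion_moufang[of x y z] octonion_ip_dia_cycle[of x y z] by (simp add:
        octonion_dia_mult)
  have 2: "dia (dia (z * x) * z) = octonion_scale (octonion_norm2 z) x"
    using octonion_left_alternative[of z x] by (simp add: octonion_dia_mult)
  have 3: "dia (y * dia (x * y)) = octonion_scale (octonion_norm2 y) x"
    using octonion_right_alternative[of x y] by (simp add: octonion_dia_mult)
  show ?thesis
    by (simp add: octonion_linear 1 2 3 algebra_simps)
qed

lemma adj_adj: "adj (adj x) = nrm x *\<^sub>A x"
  using adj_adj_off_diagonal[of "o3 x" "o1 x" "d2 x" "o2 x" "d3 x" "d1 x"]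
    adj_adj_off_diagonal[of "o1 x" "o2 x" "d3 x" "o3 x" "d1 x" "d2 x"]
    adj_adj_off_diagonal[of "o2 x" "o3 x" "d1 x" "o1 x" "d2 x" "d3 x"]
    octonion_ip_dia_cycle[of "o1 x" "o2 x" "o3 x"] octonion_ip_dia_cycle[of "o2 x" "o3 x" "o1 x"]
  by (simp add: adj_def nrm_def albert_eq_iff octonion_norm2_diff octonion_norm2_dia_mult
      octonion_norm2_scale octonion_ip_linear octonion_scale_linear power2_eq_square algebra_simps)

text \<open>Comparing coefficients of \<open>t\<close> and \<open>t\<^sup>2\<close> in \<open>(x + t y)\<^sup>#\<^sup># = N(x + t y) (x + t y)\<close>.\<close>

lemma adj_adj_linearised:
  shows "cross (adj x) (cross x y) = nrm x *\<^sub>A y + tr (adj x) y *\<^sub>A x"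
    and "adj (cross x y) + cross (adj x) (adj y) = tr (adj x) y *\<^sub>A y + tr x (adj y) *\<^sub>A x"
proof -
  define A where "A = cross (adj x) (cross x y) - nrm x *\<^sub>A y - tr (adj x) y *\<^sub>A x"
  define B where "B = adj (cross x y) + cross (adj x) (adj y) - tr (adj x) y *\<^sub>A y - tr x (adj y)
      *\<^sub>A x"
  define C where "C = cross (adj y) (cross x y) - nrm y *\<^sub>A x - tr x (adj y) *\<^sub>A y"
  \<comment> \<open>The terms of degree 0 and 4 in \<open>t\<close> cancel by
    \<open>adj_adj\<close>; \<open>A\<close>, \<open>B\<close>, \<open>C\<close> are the remaining
    coefficients, which the values 1, -1, 2 of \<open>t\<close> separate.\<close>
  have *: "t *\<^sub>A A + t\<^sup>2 *\<^sub>A B + t ^ 3 *\<^sub>A C = 0" for t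
  proof (rule tr_nondegenerate)
    fix z
    have "tr (adj (adj (x + t *\<^sub>A y))) z = tr (nrm (x + t *\<^sub>A y) *\<^sub>A (x + t *\<^sub>A y)) z"
      by (simp add: adj_adj)
    then have "tr (adj (adj x + t *\<^sub>A cross x y + t\<^sup>2 *\<^sub>A adj y)) z =
       (nrm x + t * tr (adj x) y + t\<^sup>2 * tr x (adj y) + t ^ 3 * nrm y) * (tr x z + t * tr y z)"
      by (simp add: adj_add adj_scale nrm_add nrm_scale cross_linear tr_linear)
    then show "tr (t *\<^sub>A A + t\<^sup>2 *\<^sub>A B + t ^ 3 *\<^sub>A C) z = tr 0 z"
      by (simp add: A_def B_def C_def adj_add adj_scale adj_adj cross_linear tr_linear
          cross_commute[of "adj y"] power2_eq_square power3_eq_cube algebra_simps)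
  qed
  have "tr A z = 0" "tr B z = 0" for z
  proof -
    have "tr (t *\<^sub>A A + t\<^sup>2 *\<^sub>A B + t ^ 3 *\<^sub>A C) z = 0" for t
      by (simp add: * tr_linear)
    from this[of 1] this[of "-1"] this[of 2] have "tr A z + tr B z + tr C z = 0"
      "- tr A z + tr B z - tr C z = 0" "2 * tr A z + 4 * tr B z + 8 * tr C z = 0"
      by (simp_all add: tr_linear)
    then show "tr A z = 0" "tr B z = 0"
      by algebra+
  qed
  then have "A = 0" "B = 0"
    by (auto intro!: tr_nondegenerate simp: tr_linear)
  then show "cross (adj x) (cross x y) = nrm x *\<^sub>A y + tr (adj x) y *\<^sub>A x"
    and "adj (cross x y) + cross (adj x) (adj y) = tr (adj x) y *\<^sub>A y + tr x (adj y) *\<^sub>A x"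
    by (simp_all add: A_def B_def algebra_simps)
qed

text \<open>The transpose of \<open>adj_adj_linearised(1)\<close> with respect to the trace
  form.\<close>

lemma cross_cross_adj: "cross x (cross (adj x) y) = nrm x *\<^sub>A y + tr x y *\<^sub>A adj x"
proof (rule tr_nondegenerate)
  fix z
  have "tr (cross x (cross (adj x) y)) z = tr (cross (adj x) (cross x z)) y"
    by (metis cross_commute tr_commute tr_cross_cycle)
  then show "tr (cross x (cross (adj x) y)) z = tr (nrm x *\<^sub>A y + tr x y *\<^sub>A adj x) z"
    by (simp add: adj_adj_linearised(1) tr_linear tr_commute)
qed

lemma adj_cross:
  "adj (cross x y) = tr (adj x) y *\<^sub>A y + tr x (adj y) *\<^sub>A x - cross (adj x) (adj y)"
  using adj_adj_linearised(2)[of x y] by (simp add: algebra_simps)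

lemma adj_diff: "adj (x - y) = adj x - cross x y + adj y"
  using adj_add[of x "- y"] adj_scale[of "-1" y] by (simp add: cross_linear)

section \<open>The operators U_x and the fundamental formula\<close>

lemma adj_Uop: "adj (Uop x y) = Uop (adj x) (adj y)"
  by (rule tr_nondegenerate)
    (simp add: Uop_def adj_diff adj_scale adj_cross cross_linear cross_cross_adj adj_adj tr_linear
      power2_eq_square algebra_simps)

lemma tr_Uop: "tr (Uop x y) z = tr y (Uop x z)"
proof -
  have "tr (cross (adj x) y) z = tr y (cross (adj x) z)"
    by (metis cross_commute tr_commute tr_cross_cycle)
  then show ?thesis
    by (simp add: Uop_def tr_linear tr_commute[of x])
qed

lemma Uop_linear:
  "Uop x (y + z) = Uop x y + Uop x z" "Uop x (y - z) = Uop x y - Uop x z"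
  "Uop x (c *\<^sub>A y) = c *\<^sub>A Uop x y"
  by (simp_all add: Uop_def tr_linear cross_linear algebra_simps albert.scale_left_distrib
      albert.scale_right_diff_distrib)

lemma Uop_scale: "Uop (c *\<^sub>A x) y = c\<^sup>2 *\<^sub>A Uop x y"
  by (simp add: Uop_def tr_linear cross_linear adj_scale albert.scale_right_diff_distrib
      power2_eq_square mult_ac)

lemma tr_cross_self: "tr x (cross x z) = 2 * tr (adj x) z"
  using tr_cross_cycle[of x x z] by (simp add: cross_self tr_linear tr_commute)

lemma Uop_adj: "Uop x (Uop (adj x) y) = (nrm x)\<^sup>2 *\<^sub>A y"
  by (rule tr_nondegenerate)
    (simp add: Uop_def adj_adj cross_linear tr_linear cross_self adj_adj_linearised tr_cross_self
      tr_commute[of x "adj x"] tr_adj_self power2_eq_square algebra_simps)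

lemma Uop_adj': "Uop (adj x) (Uop x y) = (nrm x)\<^sup>2 *\<^sub>A y"
  by (rule tr_nondegenerate)
    (simp add: Uop_def adj_adj cross_linear tr_linear cross_cross_adj tr_adj_self cross_self
      tr_cross_self[of "adj x"] tr_commute[of "cross (adj x) y" "adj x"] power2_eq_square
          algebra_simps)

text \<open>By Euler's identity the norm is a trace pairing with the adjoint; \<open>adj_Uop\<close>
  and self-adjointness of U then leave \<open>Uop (adj x) (Uop x y)\<close>, a multiple of
  \<open>y\<close>.\<close>

lemma nrm_Uop: "nrm (Uop x y) = (nrm x)\<^sup>2 * nrm y"
proof -
  have "3 * nrm (Uop x y) = tr (Uop (adj x) (adj y)) (Uop x y)"
    using tr_adj_self[of "Uop x y"] by (simp add: adj_Uop)
  also have "\<dots> = tr (adj y) ((nrm x)\<^sup>2 *\<^sub>A y)"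
    by (simp add: tr_Uop Uop_adj')
  also have "\<dots> = 3 * ((nrm x)\<^sup>2 * nrm y)"
    by (simp add: tr_linear tr_adj_self)
  finally show ?thesis by simp
qed

lemma cross_Uop: "cross (Uop x y) (Uop x z) = Uop (adj x) (cross y z)"
  using adj_Uop[of x "y + z"] by (simp add: Uop_linear adj_add adj_Uop algebra_simps)

text \<open>Since U_x is onto for invertible \<open>x\<close>, \<open>w\<close> may be written as
  \<open>Uop x v\<close>; then the polarised \<open>adj_Uop\<close> applies.\<close>

lemma Uop_cross_Uop:
  assumes "nrm x \<noteq> 0"
  shows "Uop x (cross w (Uop x z)) = cross (Uop (adj x) w) z"
proof -
  define v where "v = (1 / (nrm x)\<^sup>2) *\<^sub>A Uop (adj x) w"
  have "w = Uop x v"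
    using assms by (simp add: v_def Uop_linear Uop_adj)
  then show ?thesis
    by (simp add: cross_Uop Uop_adj Uop_adj' cross_linear)
qed

text \<open>The fundamental formula. The trace terms of both sides agree because U_x is
  self-adjoint, the cross terms by \<open>Uop_cross_Uop\<close>.\<close>

lemma Uop_Uop:
  assumes "nrm x \<noteq> 0"
  shows "Uop (Uop x y) z = Uop x (Uop y (Uop x z))"
  using Uop_cross_Uop[OF assms, of "adj y" z]
  by (simp add: Uop_def[of "Uop x y"] Uop_def[of y] Uop_linear adj_Uop tr_Uop)

section \<open>The Jordan product and the involution\<close>

text \<open>The Jordan product recovered from the cubic norm structure;
  \<open>jordan_albert_mat\<close> identifies it with the matrix product.\<close>

definition jor :: "albert \<Rightarrow> albert \<Rightarrow> albert" where
  "jor x y = (1/2) *\<^sub>A (cross x y + tr x 1 *\<^sub>A y + tr y 1 *\<^sub>A x - (tr x 1 * tr y 1 - tr x y) *\<^sub>A 1)"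

definition trip :: "albert \<Rightarrow> albert \<Rightarrow> albert \<Rightarrow> albert" where
  "trip x y z = (1/2) *\<^sub>A (tr x (star y) *\<^sub>A z + tr z (star y) *\<^sub>A x - cross (cross x z) (star y))"

lemma cross_one: "cross 1 x = tr x 1 *\<^sub>A 1 - x"
  by (simp add: cross_def tr_def albert_eq_iff octonion_linear)

lemma tr_one_one: "tr 1 1 = 3"
  by (simp add: tr_def octonion_linear)

lemma adj_one: "adj 1 = 1"
  by (simp add: adj_def albert_eq_iff octonion_linear octonion_norm2_def)

lemma nrm_one: "nrm 1 = 1"
  by (simp add: nrm_def octonion_norm2_def octonion_linear)

lemma Uop_one: "Uop 1 x = x"
  by (simp add: Uop_def adj_one cross_one tr_commute)

lemma jor_commute: "jor x y = jor y x"
  by (simp add: jor_def cross_commute tr_commute[of x y] algebra_simps)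

lemma jor_linear:
  "jor (x + y) z = jor x z + jor y z" "jor z (x + y) = jor z x + jor z y"
  "jor (x - y) z = jor x z - jor y z" "jor z (x - y) = jor z x - jor z y"
  "jor (c *\<^sub>A x) z = c *\<^sub>A jor x z" "jor z (c *\<^sub>A x) = c *\<^sub>A jor z x"
  by (rule tr_nondegenerate,
      simp add: jor_def cross_linear tr_linear field_simps)+

lemma jor_one: "jor 1 x = x" "jor x 1 = x"
  by (rule tr_nondegenerate,
      simp add: jor_def cross_one cross_commute[of x] tr_one_one tr_linear tr_commute[of 1 x]
          field_simps)+

lemma tr_cross_one: "tr (cross x y) 1 = tr x 1 * tr y 1 - tr x y"
  by (metis cross_one tr_cross_cycle cross_commute tr_linear(3) tr_linear(7) tr_commute)

text \<open>Obtained by comparing \<open>adj_adj_linearised(2)\<close> at \<open>y + 1\<close> with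
  its instance at \<open>y\<close>.\<close>

lemma cross_cross_self:
  "cross x (cross x y) = tr x 1 *\<^sub>A (tr (cross x y) 1 *\<^sub>A 1 - cross x y)
     + tr y 1 *\<^sub>A (tr (adj x) 1 *\<^sub>A 1 - adj x) - cross (adj x) y - tr (adj x) y *\<^sub>A 1
     - tr (adj x) 1 *\<^sub>A y - (tr x 1 * tr y 1 - tr x y) *\<^sub>A x" (is "_ = ?r")
proof (rule tr_nondegenerate)
  fix z
  have "tr (adj (cross x (y + 1)) + cross (adj x) (adj (y + 1))) z =
      tr (tr (adj x) (y + 1) *\<^sub>A (y + 1) + tr x (adj (y + 1)) *\<^sub>A x) z"
    by (simp only: adj_adj_linearised(2))
  then show "tr (cross x (cross x y)) z = tr ?r z"
    by (simp add: adj_cross adj_add adj_diff adj_scale power2_eq_square cross_linear tr_linear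
        adj_one cross_commute[of _ 1] cross_one
        tr_cross_one tr_commute[of x "cross _ _"] tr_commute[of 1] cross_commute[of "cross x y" x]
            algebra_simps)
qed

lemma tr_adj_one: "tr (adj x) 1 = ((tr x 1)\<^sup>2 - tr x x) / 2"
  using tr_cross_one[of x x] by (simp add: cross_self tr_linear power2_eq_square field_simps)

lemma tr_jor: "tr (jor x y) 1 = tr x y"
  by (simp add: jor_def tr_linear tr_cross_one tr_one_one)

text \<open>Paired with \<open>z\<close>, both sides become polynomials in a few traces. Facts 1 to
  8 unfold the nested Jordan products, fact 9 is \<open>cross_cross_self\<close>, and elimination is
  left to \<open>algebra\<close>.\<close>

lemma Uop_eq_jor: "Uop x y = 2 *\<^sub>A jor (jor x y) x - jor (jor x x) y"
proof (rule tr_nondegenerate)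
  fix z
  have 1: "2 * tr (jor (jor x y) x) z = tr (cross x (jor x y)) z + tr x y * tr x z + tr x 1 * tr
      (jor x y) z
     - (tr x y * tr x 1 - tr x (jor x y)) * tr z 1"
    by (simp add: jor_def[of "jor x y" x] tr_linear tr_jor cross_commute[of "jor x y"]
        tr_commute[of "jor x y" x] tr_commute[of 1 z])
  have 2: "2 * tr (jor (jor x x) y) z = tr (cross (jor x x) y) z + tr x x * tr y z + tr y 1 * tr
      (jor x x) z
     - (tr x x * tr y 1 - tr (jor x x) y) * tr z 1"
    by (simp add: jor_def[of "jor x x" y] tr_linear tr_jor tr_commute[of 1 z])
  have 3: "2 * tr (jor x y) z = tr (cross x y) z + tr x 1 * tr y z + tr y 1 * tr x z - (tr x 1 *
      tr y 1 - tr x y) * tr z 1"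
    and 4: "tr (jor x x) z = tr (adj x) z + tr x 1 * tr x z - tr (adj x) 1 * tr z 1"
    and 5: "tr (jor x x) y = tr (adj x) y + tr x 1 * tr x y - tr (adj x) 1 * tr y 1"
    and 6: "2 * tr x (jor x y) = 2 * tr (adj x) y + tr x 1 * tr x y + tr y 1 * tr x x - (tr x 1 *
        tr y 1 - tr x y) * tr x 1"
    by (simp_all add: jor_def tr_linear tr_commute[of 1 z] tr_commute[of 1 y] cross_self tr_adj_one
        power2_eq_square field_simps tr_cross_self)
  have 7: "2 * tr (cross x (jor x y)) z = tr (cross x (cross x y)) z + tr x 1 * tr (cross x y) z +
      2 * tr y 1 * tr (adj x) z - (tr x 1 * tr y 1 - tr x y) * (tr x 1 * tr z 1 - tr x z)"
    by (simp add: jor_def tr_linear cross_linear cross_self tr_commute[of 1 z] cross_commute[of x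
        1] cross_one)
  have 8: "tr (cross (jor x x) y) z = tr (cross (adj x) y) z + tr x 1 * tr (cross x y) z -
      tr (adj x) 1 * (tr y 1 * tr z 1 - tr y z)"
    by (simp add: jor_def tr_linear cross_linear cross_self tr_commute[of 1 z] cross_one tr_adj_one
        power2_eq_square field_simps)
  have 9: "tr (cross x (cross x y)) z = tr x 1 * ((tr x 1 * tr y 1 - tr x y) * tr z 1 - tr (cross
      x y) z)
     + tr y 1 * (tr (adj x) 1 * tr z 1 - tr (adj x) z) - tr (cross (adj x) y) z - tr (adj x) y *
         tr z 1
     - tr (adj x) 1 * tr y z - (tr x 1 * tr y 1 - tr x y) * tr x z"
    by (simp add: cross_cross_self tr_linear tr_cross_one tr_commute[of 1 z])
  have 10: "2 * tr (adj x) 1 = (tr x 1)\<^sup>2 - tr x x"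
    by (simp add: tr_adj_one)
  have "2 * tr (jor (jor x y) x) z - tr (jor (jor x x) y) z = tr x y * tr x z - tr (cross (adj x)
      y) z"
    using 1 2 3 4 5 6 7 8 9 10 by algebra
  then show "tr (Uop x y) z = tr (2 *\<^sub>A jor (jor x y) x - jor (jor x x) y) z"
    by (simp add: Uop_def tr_linear)
qed

text \<open>The case \<open>y = 1\<close> of \<open>adj_adj_linearised(1)\<close>. It yields
  \<open>jor_adj\<close>, a form of the Cayley-Hamilton theorem that later produces
  eigenprojections.\<close>

lemma cross_adj_self:
  "cross x (adj x) = (tr x 1 * tr (adj x) 1 - nrm x) *\<^sub>A 1 - tr (adj x) 1 *\<^sub>A x - tr x 1 *\<^sub>A adj x"
proof (rule tr_nondegenerate)
  fix z
  show "tr (cross x (adj x)) z =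
      tr ((tr x 1 * tr (adj x) 1 - nrm x) *\<^sub>A 1 - tr (adj x) 1 *\<^sub>A x - tr x 1 *\<^sub>A adj x) z"
    using adj_adj_linearised(1)[of x 1, THEN arg_cong, of "\<lambda>v. tr v z"]
    by (simp add: cross_commute[of _ 1] cross_one cross_linear tr_linear cross_commute[of "adj x" x]
        algebra_simps)
qed

lemma jor_adj: "jor x (adj x) = nrm x *\<^sub>A 1"
  by (rule tr_nondegenerate)
    (simp add: jor_def cross_adj_self tr_linear tr_commute[of x "adj x"] tr_adj_self field_simps)

lemma trip_eq_Uop: "trip x y x = Uop x (star y)"
  by (rule tr_nondegenerate) (simp add: trip_def Uop_def cross_self cross_linear tr_linear
      field_simps)

lemma Uop_add: "Uop (x + z) (star y) = Uop x (star y) + 2 *\<^sub>A trip x y z + Uop z (star y)"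
  by (rule tr_nondegenerate)
    (simp add: trip_def Uop_def cross_linear adj_add tr_linear field_simps)

lemma star_star [simp]: "star (star x) = x"
  by (simp add: star_def albert_eq_iff octonion_eq_iff)

text \<open>Polarisation of \<open>Uop_eq_jor\<close>: the mixed terms of U at \<open>x + z\<close>
  are compared.\<close>

lemma trip_eq_jor:
  "trip x y z = jor (jor x (star y)) z + jor x (jor (star y) z) - jor (jor x z) (star y)"
proof -
  have "2 *\<^sub>A trip x y z = 2 *\<^sub>A (jor (jor x (star y)) z + jor x (jor (star y) z) - jor (jor x z)
      (star y))"
    using Uop_add[of x z y]
    by (simp add: Uop_eq_jor jor_linear jor_commute albert.scale_right_distrib
        albert.scale_right_diff_distrib
        albert.scale_left_distrib[of 1 1, simplified] algebra_simps)
  then show ?thesis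
    by simp
qed

lemma bar_linear:
  "bar (x + y) = bar x + bar y" "bar (x - y) = bar x - bar y" "bar (- x) = - bar x"
  "bar (octonion_scale c x) = octonion_scale (cnj c) (bar x)" "bar (x * y) = bar x * bar y"
  "bar (dia x) = dia (bar x)" "bar 0 = 0" "bar 1 = 1" "bar (bar x) = x"
  "octonion_norm2 (bar x) = cnj (octonion_norm2 x)"
  "octonion_ip (bar x) (bar y) = cnj (octonion_ip x y)"
  by (simp_all add: octonion_eq_iff times_octonion_def octonion_norm2_def octonion_ip_def)

lemma star_linear:
  "star (x + y) = star x + star y" "star (x - y) = star x - star y" "star (- x) = - star x"
  "star (c *\<^sub>A x) = cnj c *\<^sub>A star x" "star 0 = 0" "star 1 = 1"
  by (simp_all add: star_def albert_eq_iff bar_linear)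

lemma tr_star: "tr (star x) (star y) = cnj (tr x y)"
  by (simp add: tr_def star_def bar_linear)

lemma adj_star: "adj (star x) = star (adj x)"
  by (simp add: adj_def star_def albert_eq_iff bar_linear)

lemma cross_star: "cross (star x) (star y) = star (cross x y)"
  by (simp add: cross_def star_def albert_eq_iff bar_linear)

lemma nrm_star: "nrm (star x) = cnj (nrm x)"
  by (simp add: nrm_def star_def bar_linear(10) flip: bar_linear(5,6,11))

lemma Uop_star: "star (Uop x y) = Uop (star x) (star y)"
  by (simp add: Uop_def star_linear tr_star adj_star cross_star)

section \<open>Positive definiteness of the hermitian trace form\<close>

lemma mult_cnj_cmod: "z * cnj z = (complex_of_real (cmod z))\<^sup>2"
  by (metis complex_norm_square of_real_power)

text \<open>The hermitian square norm. The complex quadratic form \<open>octonion_norm2\<close> has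
  nonzero isotropic vectors; the two agree on octonions fixed by \<open>bar\<close>.\<close>

definition octonion_sq :: "complex octonion \<Rightarrow> real" where
  "octonion_sq x = (cmod (cf0 x))\<^sup>2 + (cmod (cf1 x))\<^sup>2 + (cmod (cf2 x))\<^sup>2 + (cmod (cf3 x))\<^sup>2 +
     (cmod (cf4 x))\<^sup>2 + (cmod (cf5 x))\<^sup>2 + (cmod (cf6 x))\<^sup>2 + (cmod (cf7 x))\<^sup>2"

lemma octonion_sq_nonneg: "octonion_sq x \<ge> 0"
  by (simp add: octonion_sq_def)

lemma octonion_sq_eq_0: "octonion_sq x = 0 \<longleftrightarrow> x = 0"
  by (simp add: octonion_sq_def octonion_eq_iff add_nonneg_eq_0_iff)

lemma octonion_ip_bar: "octonion_ip x (bar x) = of_real (2 * octonion_sq x)"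
  by (simp add: octonion_ip_def octonion_sq_def mult_cnj_cmod power2_eq_square algebra_simps)

lemma octonion_norm2_real:
  assumes "bar x = x"
  shows "octonion_norm2 x = of_real (octonion_sq x)"
  using octonion_ip_bar[of x] octonion_ip_self[of x] by (simp add: assms)

lemma tr_star_eq_0:
  assumes "tr x (star x) = 0"
  shows "x = 0"
proof -
  have "tr x (star x) = of_real ((cmod (d1 x))\<^sup>2 + (cmod (d2 x))\<^sup>2 + (cmod (d3 x))\<^sup>2 +
      2 * octonion_sq (o1 x) + 2 * octonion_sq (o2 x) + 2 * octonion_sq (o3 x))"
    by (simp add: tr_def star_def octonion_ip_bar mult_cnj_cmod)
  then have "(cmod (d1 x))\<^sup>2 + (cmod (d2 x))\<^sup>2 + (cmod (d3 x))\<^sup>2 +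
      2 * octonion_sq (o1 x) + 2 * octonion_sq (o2 x) + 2 * octonion_sq (o3 x) = 0"
    using assms by (metis of_real_eq_0_iff)
  then show ?thesis
    by (simp add: add_nonneg_eq_0_iff octonion_sq_nonneg octonion_sq_eq_0 albert_eq_iff)
qed

section \<open>Hermitian octonion matrices and triple automorphisms\<close>

definition albert_mat :: "albert \<Rightarrow> octmat" where
  "albert_mat x = vector
     [vector [octonion_scale (d1 x) 1, o3 x, dia (o2 x)],
      vector [dia (o3 x), octonion_scale (d2 x) 1, o1 x],
      vector [o2 x, dia (o1 x), octonion_scale (d3 x) 1]]"

lemma octmat_eq_iff: "X = Y \<longleftrightarrow> (\<forall>i j. X $ i $ j = Y $ i $ (j::3))" for X Y :: octmat
  by (simp add: vec_eq_iff)

lemma albert_mat_in_C6: "albert_mat x \<in> C6"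
  by (auto simp: C6_def albert_mat_def forall_3 octonion_linear octonion_eq_iff)

lemma albert_mat_inject [simp]: "albert_mat x = albert_mat y \<longleftrightarrow> x = y"
proof
  assume "albert_mat x = albert_mat y"
  then show "x = y"
    by (auto simp: octmat_eq_iff forall_3 albert_mat_def albert_eq_iff octonion_eq_iff)
qed simp

text \<open>Applied to the diagonal entries of a matrix in \<open>C6\<close>, which are therefore
  scalars.\<close>

lemma dia_eq_self:
  fixes x :: "complex octonion"
  assumes "dia x = x"
  shows "octonion_scale (cf0 x) 1 = x"
proof -
  have neg: "- c = c \<longleftrightarrow> c = 0" for c :: complex
    by (auto simp: complex_eq_iff)
  show ?thesis
    using assms by (simp add: octonion_eq_iff neg)
qed

lemma C6_eq_range_albert_mat: "C6 = range albert_mat"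
proof (intro equalityI subsetI)
  fix X assume "X \<in> C6"
  then have X: "X $ j $ i = dia (X $ i $ j)" for i j
    unfolding C6_def by blast
  have "octonion_scale (cf0 (X $ i $ i)) 1 = X $ i $ i" for i
    by (rule dia_eq_self) (rule X[symmetric])
  moreover have "dia (X $ 3 $ 1) = X $ 1 $ 3" "dia (X $ 1 $ 2) = X $ 2 $ 1" "dia (X $ 2 $ 3) = X $
      3 $ 2"
    by (rule X[symmetric])+
  ultimately have "X = albert_mat (Albert (cf0 (X $ 1 $ 1)) (cf0 (X $ 2 $ 2)) (cf0 (X $ 3 $ 3)) (X
      $ 2 $ 3) (X $ 3 $ 1) (X $ 1 $ 2))"
    by (simp add: octmat_eq_iff albert_mat_def forall_3)
  then show "X \<in> range albert_mat"
    by blast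
qed (auto simp: albert_mat_in_C6)

lemma albert_mat_linear:
  "albert_mat (x + y) = albert_mat x + albert_mat y" "albert_mat (x - y) = albert_mat x -
      albert_mat y" "albert_mat (c *\<^sub>A x) = octmat_scale c (albert_mat x)" "albert_mat 0 = 0"
  by (simp_all add: octmat_eq_iff albert_mat_def octmat_scale_def forall_3 octonion_eq_iff)

lemma octmat_star_albert_mat: "octmat_star (albert_mat x) = albert_mat (star x)"
  by (simp add: octmat_eq_iff octmat_star_def albert_mat_def star_def forall_3 octonion_eq_iff)

lemma jor_sel:
  "d1 (jor x y) = d1 x * d1 y + (octonion_ip (o2 x) (o2 y) + octonion_ip (o3 x) (o3 y)) / 2"
  "d2 (jor x y) = d2 x * d2 y + (octonion_ip (o3 x) (o3 y) + octonion_ip (o1 x) (o1 y)) / 2"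
  "d3 (jor x y) = d3 x * d3 y + (octonion_ip (o1 x) (o1 y) + octonion_ip (o2 x) (o2 y)) / 2"
  "o1 (jor x y) = octonion_scale (1/2) (dia (o2 x * o3 y) + dia (o2 y * o3 x) +
     octonion_scale (d2 x + d3 x) (o1 y) + octonion_scale (d2 y + d3 y) (o1 x))"
  "o2 (jor x y) = octonion_scale (1/2) (dia (o3 x * o1 y) + dia (o3 y * o1 x) +
     octonion_scale (d3 x + d1 x) (o2 y) + octonion_scale (d3 y + d1 y) (o2 x))"
  "o3 (jor x y) = octonion_scale (1/2) (dia (o1 x * o2 y) + dia (o1 y * o2 x) +
     octonion_scale (d1 x + d2 x) (o3 y) + octonion_scale (d1 y + d2 y) (o3 x))"
proof -
  show "o1 (jor x y) = octonion_scale (1/2) (dia (o2 x * o3 y) + dia (o2 y * o3 x) +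
      octonion_scale (d2 x + d3 x) (o1 y) + octonion_scale (d2 y + d3 y) (o1 x))"
    "o2 (jor x y) = octonion_scale (1/2) (dia (o3 x * o1 y) + dia (o3 y * o1 x) +
      octonion_scale (d3 x + d1 x) (o2 y) + octonion_scale (d3 y + d1 y) (o2 x))"
    "o3 (jor x y) = octonion_scale (1/2) (dia (o1 x * o2 y) + dia (o1 y * o2 x) +
      octonion_scale (d1 x + d2 x) (o3 y) + octonion_scale (d1 y + d2 y) (o3 x))"
    by (simp_all add: jor_def cross_def tr_def octonion_linear)
qed (simp_all add: jor_def cross_def tr_def octonion_linear field_simps)

lemma jordan_albert_mat: "jordan (albert_mat x) (albert_mat y) = albert_mat (jor x y)"
proof -
  \<comment> \<open>Diagonal entries are compared in coordinates; off the diagonal, bilinearity and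
    \<open>octonion_dia_mult\<close> suffice.\<close>
  have "\<forall>i. jordan (albert_mat x) (albert_mat y) $ i $ i = albert_mat (jor x y) $ i $ i"
    by (simp add: forall_3 jordan_def octmat_scale_def octmat_mult_def sum_3 albert_mat_def jor_sel
        octonion_eq_iff times_octonion_def octonion_ip_def field_simps)
  moreover have "\<forall>i j. i \<noteq> j \<longrightarrow> jordan (albert_mat x) (albert_mat y) $ i $ j = albert_mat (jor x y)
      $ i $ j"
    by (simp add: forall_3 jordan_def octmat_scale_def octmat_mult_def sum_3 albert_mat_def jor_sel
        octonion_dia_mult octonion_linear algebra_simps)
  ultimately show ?thesis
    by (auto simp: octmat_eq_iff) metis
qed

lemma triple_albert_mat: "triple (albert_mat x) (albert_mat y) (albert_mat z) = albert_mat (trip x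
    y z)"
  by (simp add: triple_def trip_eq_jor octmat_star_albert_mat jordan_albert_mat albert_mat_linear)

definition albert_tripotent :: "albert \<Rightarrow> bool" where
  "albert_tripotent x \<longleftrightarrow> Uop x (star x) = x"

definition albert_unitary :: "albert \<Rightarrow> bool" where
  "albert_unitary u \<longleftrightarrow> albert_tripotent u \<and> (\<forall>x. trip u u x = x)"

lemma tripotent_albert_mat: "tripotent (albert_mat x) \<longleftrightarrow> albert_tripotent x"
  by (simp add: tripotent_def triple_albert_mat albert_mat_in_C6 albert_tripotent_def trip_eq_Uop)

lemma unitary_albert_mat: "unitary (albert_mat x) \<longleftrightarrow> albert_unitary x"
  by (simp add: unitary_def albert_unitary_def tripotent_albert_mat C6_eq_range_albert_mat
      triple_albert_mat)

lemma le_h_albert_mat: "le_h (albert_mat x) (albert_mat y) \<longleftrightarrow> albert_tripotent x \<and> albert_tripotent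
    y \<and> Uop y (star x) = x"
  by (auto simp: le_h_def tripotent_albert_mat triple_albert_mat trip_eq_Uop)

text \<open>As \<open>adj u\<close> divided by \<open>nrm u\<close> is the inverse of
  \<open>u\<close>, this says that the inverse is \<open>star u\<close>: unitarity in terms of the
  cubic norm.\<close>

definition regular :: "albert \<Rightarrow> bool" where
  "regular u \<longleftrightarrow> adj u = nrm u *\<^sub>A star u \<and> cmod (nrm u) = 1"

lemma trip_one: "trip x 1 y = jor x y"
  by (simp add: trip_eq_jor star_linear jor_one)

lemma albert_unitary_jor:
  assumes "albert_unitary u"
  shows "jor u (star u) = 1"
proof -
  have "trip u u 1 = 1"
    using assms by (simp add: albert_unitary_def)
  then show ?thesis
    by (simp add: trip_eq_jor jor_one)
qed

lemma cnj_mult_cmod_1: "cmod c = 1 \<Longrightarrow> c * cnj c = 1" "cmod c = 1 \<Longrightarrow> cnj c * c = 1"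
  by (simp_all add: mult_cnj_cmod mult.commute[of "cnj c"])

lemma albert_unitary_regular:
  assumes "albert_unitary u"
  shows "regular u"
proof -
  let ?n = "nrm u"
  have tr: "tr u (star u) = 3"
    using tr_jor[of u "star u"] by (simp add: albert_unitary_jor[OF assms] tr_one_one)
  have "Uop u (star u) = u"
    using assms by (simp add: albert_unitary_def albert_tripotent_def)
  then have "3 *\<^sub>A u - cross (adj u) (star u) = u"
    by (simp add: Uop_def tr)
  then have c: "cross (adj u) (star u) = 2 *\<^sub>A u"
    using albert.scale_left_diff_distrib[of 3 1 u] by (simp add: algebra_simps)
  then have "?n *\<^sub>A star u + 3 *\<^sub>A adj u = 4 *\<^sub>A adj u"
    using cross_cross_adj[of u "star u"] by (simp add: tr cross_linear cross_self)
  then have adj: "adj u = ?n *\<^sub>A star u"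
    using albert.scale_left_distrib[of 1 3 "adj u"] by simp
  have "u \<noteq> 0"
    using tr by (auto simp: tr_linear)
  have "(?n\<^sup>2 * cnj ?n) *\<^sub>A u = ?n *\<^sub>A u"
    using adj_adj[of u] by (simp add: adj adj_scale adj_star star_linear)
  then have "?n = ?n\<^sup>2 * cnj ?n"
    using \<open>u \<noteq> 0\<close> by (metis albert.scale_right_imp_eq)
  moreover have "?n \<noteq> 0"
    using adj c \<open>u \<noteq> 0\<close> by (auto simp: cross_linear)
  ultimately have "?n * cnj ?n = 1"
    by (simp add: power2_eq_square)
  then have "cmod ?n = 1"
    by (metis complex_mod_cnj complex_mod_mult_cnj norm_one power_eq_1_iff zero_neq_numeral
        norm_ge_zero real_sqrt_abs real_sqrt_one power2_eq_square abs_norm_cancel)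
  then show ?thesis
    using adj by (simp add: regular_def)
qed

lemma regular_star_eq:
  assumes "regular r"
  shows "star r = cnj (nrm r) *\<^sub>A adj r"
  using assms by (simp add: regular_def cnj_mult_cmod_1)

lemma Uop_regular_star:
  assumes "regular r"
  shows "Uop r (Uop (star r) y) = y" "Uop (star r) (Uop r y) = y"
proof -
  have "cnj (nrm r) * nrm r = 1"
    using assms by (simp add: regular_def cnj_mult_cmod_1)
  then show "Uop r (Uop (star r) y) = y" "Uop (star r) (Uop r y) = y"
    unfolding regular_star_eq[OF assms]
    by (simp_all add: Uop_scale Uop_linear Uop_adj Uop_adj' flip: power_mult_distrib)
qed

section \<open>Triple automorphisms and Jordan automorphisms\<close>

lemma regular_nrm: "regular r \<Longrightarrow> nrm r \<noteq> 0"
  by (auto simp: regular_def)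

text \<open>Multiplicativity is required for {x,y,x} only and polarised in
  \<open>triple_aut_trip\<close>. The last clause keeps track of how the determinant
  changes.\<close>

definition triple_aut :: "(albert \<Rightarrow> albert) \<Rightarrow> bool" where
  "triple_aut \<phi> \<longleftrightarrow> bij \<phi> \<and> (\<forall>x y. \<phi> (x + y) = \<phi> x + \<phi> y) \<and> (\<forall>c x. \<phi> (c *\<^sub>A x) = c *\<^sub>A \<phi> x) \<and>
     (\<forall>x y. \<phi> (Uop x (star y)) = Uop (\<phi> x) (star (\<phi> y))) \<and>
     (\<exists>\<kappa>. cmod \<kappa> = 1 \<and> (\<forall>x. nrm (\<phi> x) = \<kappa> * nrm x))"

lemma triple_autD:
  assumes "triple_aut \<phi>"
  shows "bij \<phi>" "\<phi> (x + y) = \<phi> x + \<phi> y" "\<phi> (c *\<^sub>A x) = c *\<^sub>A \<phi> x"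
    "\<phi> (Uop x (star y)) = Uop (\<phi> x) (star (\<phi> y))"
  using assms by (simp_all add: triple_aut_def)

text \<open>Between U_x and y* one inserts the identity as U_r composed with U at
  \<open>star r\<close>, and the fundamental formula absorbs the outer factors.\<close>

lemma triple_aut_Uop:
  assumes "regular r"
  shows "triple_aut (Uop r)"
proof -
  have "bij (Uop r)"
    by (rule o_bij[of "Uop (star r)"]) (auto simp: fun_eq_iff Uop_regular_star[OF assms])
  moreover have "Uop r (Uop x (star y)) = Uop (Uop r x) (star (Uop r y))" for x y
    by (simp add: Uop_Uop[OF regular_nrm[OF assms]] Uop_star Uop_regular_star[OF assms])
  moreover have "cmod ((nrm r)\<^sup>2) = 1"
    using assms by (simp add: regular_def norm_power)
  ultimately show ?thesis
    unfolding triple_aut_def using nrm_Uop[of r] Uop_linear[of r] by blast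
qed

lemma triple_aut_comp:
  assumes "triple_aut \<phi>" "triple_aut \<psi>"
  shows "triple_aut (\<lambda>x. \<phi> (\<psi> x))"
proof -
  obtain \<kappa> \<mu> where "cmod \<kappa> = 1" "\<And>x. nrm (\<phi> x) = \<kappa> * nrm x" "cmod \<mu> = 1" "\<And>x. nrm (\<psi> x) = \<mu> * nrm x"
    using assms unfolding triple_aut_def by blast
  then have "cmod (\<kappa> * \<mu>) = 1" "\<And>x. nrm (\<phi> (\<psi> x)) = (\<kappa> * \<mu>) * nrm x"
    by (simp_all add: norm_mult)
  moreover have "bij (\<lambda>x. \<phi> (\<psi> x))"
    using assms bij_comp[of \<psi> \<phi>] by (simp add: triple_aut_def comp_def)
  ultimately show ?thesis
    using assms unfolding triple_aut_def by metis
qed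

lemma triple_aut_inv:
  assumes "triple_aut \<phi>"
  shows "triple_aut (inv \<phi>)"
proof -
  have b: "bij \<phi>" and inj: "inj \<phi>"
    using assms by (auto simp: triple_aut_def bij_is_inj)
  have s [simp]: "\<phi> (inv \<phi> x) = x" for x
    using b by (meson bij_is_surj surj_f_inv_f)
  obtain \<kappa> where \<kappa>: "cmod \<kappa> = 1" "\<And>x. nrm (\<phi> x) = \<kappa> * nrm x"
    using assms unfolding triple_aut_def by blast
  have "nrm (inv \<phi> x) = cnj \<kappa> * nrm x" for x
    using \<kappa>(2)[of "inv \<phi> x"] cnj_mult_cmod_1[OF \<kappa>(1)] by (simp add: mult.assoc[symmetric])
  moreover have "inv \<phi> (x + y) = inv \<phi> x + inv \<phi> y" "inv \<phi> (c *\<^sub>A x) = c *\<^sub>A inv \<phi> x"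
     "inv \<phi> (Uop x (star y)) = Uop (inv \<phi> x) (star (inv \<phi> y))" for x y c
    by (rule injD[OF inj], simp add: triple_autD[OF assms])+
  moreover have "cmod (cnj \<kappa>) = 1"
    using \<kappa> by simp
  ultimately show ?thesis
    unfolding triple_aut_def using b bij_imp_bij_inv by blast
qed

lemma triple_aut_trip:
  assumes "triple_aut \<phi>"
  shows "\<phi> (trip x y z) = trip (\<phi> x) (\<phi> y) (\<phi> z)"
proof -
  have "\<phi> (Uop (x + z) (star y)) = Uop (\<phi> x + \<phi> z) (star (\<phi> y))"
    by (simp only: triple_autD(2,4)[OF assms])
  then have "2 *\<^sub>A \<phi> (trip x y z) = 2 *\<^sub>A trip (\<phi> x) (\<phi> y) (\<phi> z)"
    by (simp add: Uop_add triple_autD[OF assms])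
  then show ?thesis
    by simp
qed

lemma triple_aut_diff: "triple_aut \<phi> \<Longrightarrow> \<phi> (x - y) = \<phi> x - \<phi> y"
  by (metis add_diff_cancel_right' diff_add_cancel triple_aut_def)

lemma triple_aut_albert_tripotent: "triple_aut \<phi> \<Longrightarrow> albert_tripotent x \<Longrightarrow> albert_tripotent (\<phi> x)"
  by (metis triple_aut_def albert_tripotent_def)

lemma triple_aut_albert_unitary:
  assumes "triple_aut \<phi>" "albert_unitary x"
  shows "albert_unitary (\<phi> x)"
proof -
  have "trip (\<phi> x) (\<phi> x) y = y" for y
  proof -
    obtain z where "y = \<phi> z"
      using assms(1) unfolding triple_aut_def by (metis bij_pointE)
    then show ?thesis
      using assms(2) by (simp add: albert_unitary_def flip: triple_aut_trip[OF assms(1)])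
  qed
  then show ?thesis
    using assms triple_aut_albert_tripotent by (auto simp: albert_unitary_def)
qed

text \<open>Fixing 1 makes a triple automorphism respect \<open>star\<close> and \<open>jor\<close>,
  as {1,x,1} = x* and {x,1,y} is the Jordan product.\<close>

definition jordan_aut :: "(albert \<Rightarrow> albert) \<Rightarrow> bool" where
  "jordan_aut \<phi> \<longleftrightarrow> triple_aut \<phi> \<and> \<phi> 1 = 1"

lemma jordan_aut_comp: "jordan_aut \<phi> \<Longrightarrow> jordan_aut \<psi> \<Longrightarrow> jordan_aut (\<lambda>x. \<phi> (\<psi> x))"
  by (simp add: jordan_aut_def triple_aut_comp)

lemma jordan_aut_inv: "jordan_aut \<phi> \<Longrightarrow> jordan_aut (inv \<phi>)"
  unfolding jordan_aut_def by (metis bij_is_inj inv_f_f triple_aut_def triple_aut_inv)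

lemma jordan_aut_id: "jordan_aut (\<lambda>x. x)"
proof -
  have "Uop 1 = (\<lambda>x. x)"
    by (simp add: fun_eq_iff Uop_one)
  then show ?thesis
    using triple_aut_Uop[of 1] by (simp add: jordan_aut_def regular_def nrm_one adj_one star_linear)
qed

lemma jordan_aut_star: "jordan_aut \<phi> \<Longrightarrow> \<phi> (star x) = star (\<phi> x)"
  unfolding jordan_aut_def triple_aut_def by (metis Uop_one)

lemma jordan_aut_jor: "jordan_aut \<phi> \<Longrightarrow> \<phi> (jor x y) = jor (\<phi> x) (\<phi> y)"
  using triple_aut_trip[of \<phi> x 1 y] by (simp add: trip_one jordan_aut_def)

lemma jordan_aut_nrm:
  assumes "jordan_aut \<phi>"
  shows "nrm (\<phi> x) = nrm x"
proof -
  obtain \<kappa> where \<kappa>: "\<And>x. nrm (\<phi> x) = \<kappa> * nrm x"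
    using assms unfolding jordan_aut_def triple_aut_def by blast
  from this[of 1] have "\<kappa> = 1"
    using assms by (simp add: jordan_aut_def nrm_one)
  then show ?thesis
    using \<kappa> by simp
qed

lemma jordan_aut_linear:
  assumes "jordan_aut \<phi>"
  shows "\<phi> (x + y) = \<phi> x + \<phi> y" "\<phi> (x - y) = \<phi> x - \<phi> y" "\<phi> (c *\<^sub>A x) = c *\<^sub>A \<phi> x" "\<phi> 0 = 0" "\<phi> 1 =
      1"
  using assms by (auto simp: triple_aut_diff jordan_aut_def triple_aut_def) (metis
      add_cancel_left_left)

lemma jordan_aut_tr:
  assumes "jordan_aut \<phi>"
  shows "tr (\<phi> x) (\<phi> y) = tr x y"
proof -
  \<comment> \<open>The norm determines the linear trace, through the odd part of N(1 + x); the
    bilinear trace is the linear trace of \<open>jor x y\<close>.\<close>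
  have 1: "tr x 1 = (nrm (1 + x) - nrm (1 - x)) / 2 - nrm x" for x
    using nrm_add[of 1 x] nrm_add[of 1 "- x"] nrm_scale[of "-1" x] adj_scale[of "-1" x]
    by (simp add: nrm_one adj_one tr_linear tr_commute[of 1 x] add_divide_distrib)
  have "tr (\<phi> x) 1 = tr x 1" for x
    using 1[of "\<phi> x"] 1[of x] jordan_aut_nrm[OF assms, of "1 + x"] jordan_aut_nrm[OF assms, of "1
        - x"]
    by (simp add: jordan_aut_linear[OF assms] jordan_aut_nrm[OF assms])
  from this[of "jor x y"] show ?thesis
    by (simp add: jordan_aut_jor[OF assms] tr_jor)
qed

lemma adj_eq_jor: "adj x = jor x x - tr x 1 *\<^sub>A x + (((tr x 1)\<^sup>2 - tr x x) / 2) *\<^sub>A 1"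
  by (rule tr_nondegenerate) (simp add: jor_def tr_linear cross_self power2_eq_square field_simps)

lemma jordan_aut_adj:
  assumes "jordan_aut \<phi>"
  shows "\<phi> (adj x) = adj (\<phi> x)"
  using jordan_aut_tr[OF assms, of x 1]
  by (simp add: adj_eq_jor jordan_aut_jor[OF assms] jordan_aut_linear[OF assms] jordan_aut_tr[OF
      assms])

section \<open>Diagonalisation\<close>

definition diag :: "complex \<Rightarrow> complex \<Rightarrow> complex \<Rightarrow> albert" where
  "diag a b c = Albert a b c 0 0 0"

lemma diag_sel [simp]:
  "d1 (diag a b c) = a" "d2 (diag a b c) = b" "d3 (diag a b c) = c"
  "o1 (diag a b c) = 0" "o2 (diag a b c) = 0" "o3 (diag a b c) = 0"
  by (simp_all add: diag_def)

lemma diag_linear: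
  "diag a b c + diag a' b' c' = diag (a + a') (b + b') (c + c')"
  "t *\<^sub>A diag a b c = diag (t * a) (t * b) (t * c)" "1 = diag 1 1 1"
  "star (diag a b c) = diag (cnj a) (cnj b) (cnj c)"
  by (simp_all add: albert_eq_iff octonion_linear star_def bar_linear)

text \<open>Up to sign these are the elements \<open>2 m - 1\<close> with a rank-one projection
  \<open>m\<close>. The trace condition is what makes \<open>Uop s 1 = 1\<close>.\<close>

definition reflection :: "albert \<Rightarrow> bool" where
  "reflection s \<longleftrightarrow> star s = s \<and> adj s = nrm s *\<^sub>A s \<and> (nrm s = 1 \<or> nrm s = -1) \<and> tr s 1 = - nrm s"

lemma jordan_aut_Uop:
  assumes "reflection s"
  shows "jordan_aut (Uop s)"
proof -
  have "regular s"
    using assms by (auto simp: reflection_def regular_def)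
  moreover have "Uop s 1 = 1"
    using assms by (auto simp: reflection_def Uop_def cross_linear cross_commute[of _ 1] cross_one)
  ultimately show ?thesis
    by (simp add: jordan_aut_def triple_aut_Uop)
qed

lemma reflectionI:
  assumes "star s = s" "adj s = s" "tr s 1 = -1" "s \<noteq> 0"
  shows "reflection s"
proof -
  have "nrm s *\<^sub>A s = 1 *\<^sub>A s"
    using adj_adj[of s] assms by simp
  then have "nrm s = 1"
    using assms(4) by (metis albert.scale_right_imp_eq)
  then show ?thesis
    using assms by (simp add: reflection_def)
qed

text \<open>\<open>?s\<close> is the permutation matrix that exchanges the first two
  coordinates.\<close>

lemma swap12: "\<exists>\<phi>. jordan_aut \<phi> \<and> (\<forall>x. d1 (\<phi> x) = d2 x \<and> d2 (\<phi> x) = d1 x \<and> d3 (\<phi> x) = d3 x) \<and>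
    (\<forall>a b c. \<phi> (diag a b c) = diag b a c)"
proof -
  let ?s = "Albert 0 0 1 0 0 1"
  have adj: "adj ?s = - ?s"
    by (simp add: albert_eq_iff adj_def octonion_linear octonion_norm2_def)
  moreover have "nrm ?s = -1"
    by (simp add: nrm_def octonion_linear octonion_norm2_def)
  ultimately have "reflection ?s"
    by (simp add: reflection_def star_def bar_linear tr_def octonion_linear)
  moreover have "d1 (Uop ?s x) = d2 x \<and> d2 (Uop ?s x) = d1 x \<and> d3 (Uop ?s x) = d3 x" for x
    by (simp add: Uop_def adj cross_linear cross_def tr_def octonion_linear)
  moreover have "Uop ?s (diag a b c) = diag b a c" for a b c
    by (simp add: albert_eq_iff Uop_def adj cross_linear cross_def tr_def octonion_linear)
  ultimately show ?thesis
    using jordan_aut_Uop by blast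
qed

lemma swap13: "\<exists>\<phi>. jordan_aut \<phi> \<and> (\<forall>x. d1 (\<phi> x) = d3 x \<and> d2 (\<phi> x) = d2 x \<and> d3 (\<phi> x) = d1 x) \<and>
    (\<forall>a b c. \<phi> (diag a b c) = diag c b a)"
proof -
  let ?s = "Albert 0 1 0 0 1 0"
  have adj: "adj ?s = - ?s"
    by (simp add: albert_eq_iff adj_def octonion_linear octonion_norm2_def)
  moreover have "nrm ?s = -1"
    by (simp add: nrm_def octonion_linear octonion_norm2_def)
  ultimately have "reflection ?s"
    by (simp add: reflection_def star_def bar_linear tr_def octonion_linear)
  moreover have "d1 (Uop ?s x) = d3 x \<and> d2 (Uop ?s x) = d2 x \<and> d3 (Uop ?s x) = d1 x" for x
    by (simp add: Uop_def adj cross_linear cross_def tr_def octonion_linear)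
  moreover have "Uop ?s (diag a b c) = diag c b a" for a b c
    by (simp add: albert_eq_iff Uop_def adj cross_linear cross_def tr_def octonion_linear)
  ultimately show ?thesis
    using jordan_aut_Uop by blast
qed

section \<open>The spectral theorem for hermitian elements\<close>

lemma cubic_real_root: "\<exists>t::real. t ^ 3 + a * t\<^sup>2 + b * t + c = 0"
proof -
  let ?f = "\<lambda>t::real. t ^ 3 + a * t\<^sup>2 + b * t + c"
  \<comment> \<open>At \<open>M\<close> and \<open>- M\<close> the cube dominates the lower-order
    terms, so the sign changes.\<close>
  define M where "M = 1 + \<bar>a\<bar> + \<bar>b\<bar> + \<bar>c\<bar>"
  have M: "M \<ge> 1"
    by (simp add: M_def)
  have bound: "\<bar>a * t\<^sup>2 + b * t + c\<bar> \<le> M ^ 3" if "\<bar>t\<bar> = M" for t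
  proof -
    have "\<bar>t\<bar> \<le> M\<^sup>2" "1 \<le> M\<^sup>2" "t\<^sup>2 = M\<^sup>2"
      using M that by (auto simp: power2_eq_square mult_ge1_I simp flip: abs_mult_self_eq[of t])
    then have "\<bar>b * t\<bar> \<le> \<bar>b\<bar> * M\<^sup>2" "\<bar>c\<bar> \<le> \<bar>c\<bar> * M\<^sup>2" "\<bar>a * t\<^sup>2\<bar> = \<bar>a\<bar> * M\<^sup>2"
      by (auto simp: abs_mult mult_left_mono mult_le_cancel_left1)
    moreover have "\<bar>a * t\<^sup>2 + b * t + c\<bar> \<le> \<bar>a * t\<^sup>2\<bar> + \<bar>b * t\<bar> + \<bar>c\<bar>"
      by linarith
    ultimately have "\<bar>a * t\<^sup>2 + b * t + c\<bar> \<le> (\<bar>a\<bar> + \<bar>b\<bar> + \<bar>c\<bar>) * M\<^sup>2"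
      by (simp add: distrib_right)
    also have "\<dots> \<le> M * M\<^sup>2"
      by (intro mult_right_mono) (auto simp: M_def)
    finally show ?thesis
      by (simp add: power2_eq_square power3_eq_cube)
  qed
  have "?f (- M) \<le> 0" "0 \<le> ?f M"
    using bound[of M] bound[of "- M"] M by auto
  then have "\<exists>t\<ge>- M. t \<le> M \<and> ?f t = 0"
    using M by (intro IVT') (auto intro!: continuous_intros)
  then show ?thesis
    by blast
qed

lemma cnj_eq_self: "cnj z = z \<Longrightarrow> z = of_real (Re z)"
  by (simp add: complex_eq_iff)

lemma uminus_homogeneous: "nrm (- x) = - nrm x" "adj (- x) = adj x"
  using nrm_scale[of "-1" x] adj_scale[of "-1" x] by simp_all

text \<open>The coefficients of the characteristic cubic are real, being fixed by
  conjugation.\<close>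

lemma hermitian_eigenvalue:
  assumes "star h = h"
  shows "\<exists>t::real. nrm (h - of_real t *\<^sub>A 1) = 0"
proof -
  have 1: "nrm h = of_real (Re (nrm h))" "tr h 1 = of_real (Re (tr h 1))" "tr (adj h) 1 = of_real
      (Re (tr (adj h) 1))"
    using nrm_star[of h] tr_star[of h 1] tr_star[of "adj h" 1] adj_star[of h]
    by (auto intro!: cnj_eq_self simp: assms star_linear)
  obtain t where "t ^ 3 + (- Re (tr h 1)) * t\<^sup>2 + Re (tr (adj h) 1) * t + (- Re (nrm h)) = 0"
    using cubic_real_root by blast
  then have "complex_of_real (t ^ 3 + (- Re (tr h 1)) * t\<^sup>2 + Re (tr (adj h) 1) * t + (- Re (nrm
      h))) = 0"
    by simp
  then have "of_real t ^ 3 - tr h 1 * of_real t ^ 2 + tr (adj h) 1 * of_real t - nrm h = 0"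
    by (simp add: 1[symmetric])
  moreover have "nrm (h - of_real t *\<^sub>A 1) = nrm h - of_real t * tr (adj h) 1 + (of_real t)\<^sup>2 * tr
      h 1 - of_real t ^ 3"
    using nrm_add[of h "(- of_real t) *\<^sub>A 1"]
    by (simp add: nrm_scale adj_scale uminus_homogeneous tr_linear adj_one nrm_one)
  ultimately show ?thesis
    by (intro exI[of _ t]) (simp add: algebra_simps)
qed

lemma jor_self: "jor x x = adj x + tr x 1 *\<^sub>A x - tr (adj x) 1 *\<^sub>A 1"
  by (simp add: adj_eq_jor[of x] tr_linear tr_jor tr_one_one power2_eq_square field_simps)

text \<open>With \<open>adj q = 0\<close> the form T(q,q) is the square of the trace, and T is
  definite on hermitian elements.\<close>

lemma hermitian_rank_one_trace:
  assumes "star q = q" "adj q = 0" "q \<noteq> 0"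
  shows "tr q 1 \<noteq> 0"
proof
  assume "tr q 1 = 0"
  then have "tr q (star q) = 0"
    using tr_adj_one[of q] assms by (simp add: tr_linear)
  then show False
    using assms(3) tr_star_eq_0 by blast
qed

text \<open>If \<open>N(y) = 0\<close>, then \<open>y\<^sup>#\<close> has rank at most one and
  \<open>y \<circ> y\<^sup># = 0\<close>; if \<open>y\<^sup># = 0\<close>, then \<open>y\<close> itself has rank at most one.\<close>

lemma exists_eigenprojection:
  assumes "star y = y" "nrm y = 0"
  shows "\<exists>p \<mu>. star p = p \<and> adj p = 0 \<and> tr p 1 = 1 \<and> jor p y = \<mu> *\<^sub>A p"
proof -
  have norm: "star ((1 / tr q 1) *\<^sub>A q) = (1 / tr q 1) *\<^sub>A q \<and> adj ((1 / tr q 1) *\<^sub>A q) = 0 \<and> tr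
      ((1 / tr q 1) *\<^sub>A q) 1 = 1"
    if "star q = q" "adj q = 0" "q \<noteq> 0" for q
    using hermitian_rank_one_trace[OF that] that tr_star[of q 1]
    by (simp add: star_linear adj_scale tr_linear)
  consider "adj y \<noteq> 0" | "adj y = 0" "y \<noteq> 0" | "y = 0"
    by blast
  then show ?thesis
  proof cases
    case 1
    have "star (adj y) = adj y" "adj (adj y) = 0"
      using assms by (simp_all add: adj_adj flip: adj_star)
    moreover have "jor ((1 / tr (adj y) 1) *\<^sub>A adj y) y = 0 *\<^sub>A ((1 / tr (adj y) 1) *\<^sub>A adj y)"
      using assms by (simp add: jor_linear jor_commute[of "adj y" y] jor_adj)
    ultimately show ?thesis
      using norm 1 by blast
  next
    case 2
    then have "jor ((1 / tr y 1) *\<^sub>A y) y = tr y 1 *\<^sub>A ((1 / tr y 1) *\<^sub>A y)"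
      by (simp add: jor_linear jor_self tr_linear)
    then show ?thesis
      using norm 2 assms by blast
  next
    case 3
    have "star (diag 1 0 0) = diag 1 0 0" "adj (diag 1 0 0) = 0" "tr (diag 1 0 0) 1 = 1"
      by (simp_all add: diag_linear adj_def tr_def albert_eq_iff octonion_linear octonion_norm2_def)
    moreover have "jor (diag 1 0 0) y = 0 *\<^sub>A diag 1 0 0"
      using 3 jor_linear(4)[of "diag 1 0 0" 0 0] by simp
    ultimately show ?thesis
      by blast
  qed
qed

lemma rank_one_to_first_aux:
  assumes "star p = p" "adj p = 0" "tr p 1 = 1" "d1 p \<noteq> 0"
  shows "\<exists>\<phi>. jordan_aut \<phi> \<and> \<phi> p = diag 1 0 0"
proof -
  obtain a1 a2 a3 x1 x2 x3 where p: "p = Albert a1 a2 a3 x1 x2 x3"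
    by (cases p)
  have re_part: "cnj a1 = a1" "cnj a2 = a2" "cnj a3 = a3" "bar x1 = x1" "bar x2 = x2" "bar x3 = x3"
    using assms(1) by (simp_all add: p star_def)
  have n: "octonion_norm2 x1 = a2 * a3" "octonion_norm2 x2 = a3 * a1" "octonion_norm2 x3 = a1 * a2"
    and x: "dia (x2 * x3) = octonion_scale a1 x1" "dia (x3 * x1) = octonion_scale a2 x2" "dia (x1
        * x2) = octonion_scale a3 x3"
    using assms(2) by (simp_all add: p adj_def albert_eq_iff)
  have sum: "a1 + a2 + a3 = 1"
    using assms(3) by (simp add: p tr_def octonion_linear)
  \<comment> \<open>The (1,1) entry of p squared equals p; it shows that \<open>a1\<close> is
    nonnegative.\<close>
  have "a1 = a1 * a1 + octonion_norm2 x2 + octonion_norm2 x3"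
    using sum unfolding n by algebra
  also have "\<dots> = of_real ((Re a1)\<^sup>2 + octonion_sq x2 + octonion_sq x3)"
    by (simp add: octonion_norm2_real re_part power2_eq_square flip: cnj_eq_self[OF re_part(1)])
  finally have "Re a1 = (Re a1)\<^sup>2 + octonion_sq x2 + octonion_sq x3"
    by (metis Re_complex_of_real)
  then have "Re a1 \<ge> 0"
    using octonion_sq_nonneg[of x2] octonion_sq_nonneg[of x3] zero_le_power2[of "Re a1"] by linarith
  \<comment> \<open>\<open>r\<close> is the cosine of the angle between \<open>p\<close> and the
    first matrix unit. Below, \<open>v\<close> and \<open>w\<close> name the two inverses so that
    \<open>algebra\<close> can work with polynomial relations only.\<close>
  define t where "t = sqrt (Re a1)"
  define r where "r = complex_of_real t"
  have a1: "a1 = r * r"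
    using \<open>Re a1 \<ge> 0\<close> cnj_eq_self[OF re_part(1)] by (simp add: r_def t_def flip: of_real_mult)
  then have r0: "r \<noteq> 0"
    using assms(4) p by auto
  have r1: "1 + r \<noteq> 0"
    using \<open>Re a1 \<ge> 0\<close> by (auto simp: r_def t_def complex_eq_iff) (smt (verit) real_sqrt_ge_zero)
  have rr: "cnj r = r"
    by (simp add: r_def)
  have a3: "a3 = 1 - r * r - a2"
    using sum a1 by (simp add: algebra_simps)
  define v where "v = 1 / r"
  define w where "w = 1 / (1 + r)"
  have rel: "r * v = 1" "(1 + r) * w = 1" "a1 = r * r" "a3 = 1 - r * r - a2"
    using r0 r1 a1 a3 by (simp_all add: v_def w_def)
  \<comment> \<open>\<open>s = 2 m - 1\<close>, where \<open>m\<close> is the rank-one projection bisecting \<open>p\<close> and the first matrix unit\<close>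
  define s where "s = Albert r (a2 * w - 1) (a3 * w - 1)
    (octonion_scale w x1) (octonion_scale v x2) (octonion_scale v x3)"
  have adj: "adj s = s"
  proof -
    have "d1 (adj s) = r" "d2 (adj s) = a2 * w - 1" "d3 (adj s) = a3 * w - 1"
      unfolding s_def adj_def albert.sel octonion_norm2_scale n using rel by algebra+
    \<comment> \<open>These are the coefficients of \<open>x1\<close>, \<open>x2\<close>,
      \<open>x3\<close> in the off-diagonal entries of \<open>adj s\<close>; the products of the
      \<open>x\<close>'s were reduced by fact \<open>x\<close>.\<close>
    moreover have "v * v * a1 - r * w = w"
      using rel by algebra
    moreover have "w * v * a2 - (a2 * w - 1) * v = v" "v * w * a3 - (a3 * w - 1) * v = v"
      by (simp_all add: algebra_simps)
    ultimately have "d1 (adj s) = r" "d2 (adj s) = a2 * w - 1" "d3 (adj s) = a3 * w - 1"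
      "o1 (adj s) = octonion_scale w x1" "o2 (adj s) = octonion_scale v x2" "o3 (adj s) =
          octonion_scale v x3"
      by (simp_all add: s_def adj_def octonion_mult_bilinear dia_linear x octonion_scale_linear(5)
          mult.assoc
          flip: octonion_scale_linear(4))
    then show ?thesis
      by (simp add: s_def albert_eq_iff)
  qed
  have "reflection s"
  proof (rule reflectionI)
    show "star s = s"
      by (simp add: s_def star_def bar_linear re_part rr v_def w_def)
    show "adj s = s"
      by (fact adj)
    have "r + (a2 * w - 1) + (a3 * w - 1) = -1"
      using rel by algebra
    then show "tr s 1 = - 1"
      by (simp add: s_def tr_def octonion_linear)
    show "s \<noteq> 0"
      using r0 by (simp add: s_def albert_eq_iff)
  qed
  moreover have "Uop s p = diag 1 0 0"
  proof -
    have "tr s p = r * a1 + (a2 * w - 1) * a2 + (a3 * w - 1) * a3 + w * (2 * (a2 * a3)) + v * (2 *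
        (a3 * a1)) + v * (2 * (a1 * a2))"
      by (simp add: s_def p tr_def octonion_ip_linear octonion_ip_self n)
    also have "\<dots> = r"
      using rel by algebra
    finally have U: "Uop s p = r *\<^sub>A s - cross s p"
      by (simp add: Uop_def adj)
    have "d1 (Uop s p) = 1" "d2 (Uop s p) = 0" "d3 (Uop s p) = 0"
      unfolding U unfolding s_def p cross_def albert_sel albert.sel octonion_ip_linear
          octonion_ip_self n using rel by algebra+
    moreover have "r * w - (v * a1 + v * a1 - r - a1 * w) = 0" "r * v - (v * a2 + w * a2 - (a2 * w
        - 1) - a2 * v) = 0"
      "r * v - (w * a3 + v * a3 - (a3 * w - 1) - a3 * v) = 0"
      using rel by algebra+
    then have "o1 (Uop s p) = octonion_scale 0 x1" "o2 (Uop s p) = octonion_scale 0 x2" "o3 (Uop s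
        p) = octonion_scale 0 x3"
      unfolding U by (simp_all only: s_def p cross_def albert_sel albert.sel
          octonion_mult_bilinear dia_linear x
          octonion_scale_linear(5) flip: octonion_scale_linear(3,4))
    ultimately show ?thesis
      by (simp add: albert_eq_iff octonion_linear)
  qed
  ultimately show ?thesis
    using jordan_aut_Uop by blast
qed

text \<open>The trace is 1, so some diagonal entry is nonzero; a swap brings it to the first
  place.\<close>

lemma rank_one_to_first:
  assumes "star p = p" "adj p = 0" "tr p 1 = 1"
  shows "\<exists>\<phi>. jordan_aut \<phi> \<and> \<phi> p = diag 1 0 0"
proof -
  have step: ?thesis if \<phi>: "jordan_aut \<phi>" "d1 (\<phi> p) \<noteq> 0" for \<phi>
  proof -
    have "star (\<phi> p) = \<phi> p" "adj (\<phi> p) = 0" "tr (\<phi> p) 1 = 1"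
      using \<phi>(1) assms jordan_aut_tr[OF \<phi>(1), of p 1]
      by (simp_all add: jordan_aut_linear flip: jordan_aut_star jordan_aut_adj)
    then obtain \<psi> where "jordan_aut \<psi>" "\<psi> (\<phi> p) = diag 1 0 0"
      using rank_one_to_first_aux \<phi>(2) by blast
    then show ?thesis
      using jordan_aut_comp[OF _ \<phi>(1)] by blast
  qed
  have "d1 p + d2 p + d3 p = 1"
    using assms(3) by (simp add: tr_def octonion_linear)
  then consider "d1 p \<noteq> 0" | "d2 p \<noteq> 0" | "d3 p \<noteq> 0"
    by fastforce
  then show ?thesis
  proof cases
    case 1 then show ?thesis using step[OF jordan_aut_id] by simp
  next
    case 2 then show ?thesis using swap12 step by metis
  next
    case 3 then show ?thesis using swap13 step by metis
  qed
qed

lemma octonion_norm2_zero: "octonion_norm2 0 = 0"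
  by (simp add: octonion_norm2_def)

text \<open>Only one octonion \<open>x\<close> occurs, so the lower block behaves like a complex
  hermitian 2x2 matrix. Fixing the first matrix unit allows a later use without disturbing a part
  that is already diagonal.\<close>

lemma diagonalise_block:
  assumes "star h = h" "o2 h = 0" "o3 h = 0"
  shows "\<exists>\<phi> a b c. jordan_aut \<phi> \<and> \<phi> (diag 1 0 0) = diag 1 0 0 \<and> \<phi> h = diag a b c"
proof (cases "o1 h = 0")
  case True
  then have "h = diag (d1 h) (d2 h) (d3 h)"
    using assms by (simp add: albert_eq_iff)
  then show ?thesis
    using jordan_aut_id by blast
next
  case False
  obtain a b c x where h: "h = Albert a b c x 0 0"
    using assms by (cases h) auto
  have re_part: "cnj a = a" "cnj b = b" "cnj c = c" "bar x = x"
    using assms(1) by (simp_all add: h star_def)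
  \<comment> \<open>The traceless part of the block has diagonal \<open>D\<close>,
    \<open>- D\<close> and eigenvalues \<rho>, -\<rho>; \<open>K\<close> normalises the sum of that
    part and diag(\<rho>, -\<rho>).\<close>
  define D where "D = Re ((b - c) / 2)"
  define n where "n = octonion_sq x"
  define \<rho> where "\<rho> = sqrt (D\<^sup>2 + n)"
  define K where "K = sqrt ((D + \<rho>)\<^sup>2 + n)"
  have "n > 0"
    using False octonion_sq_nonneg[of x] octonion_sq_eq_0[of x] by (simp add: n_def h)
  have rho2: "\<rho>\<^sup>2 = D\<^sup>2 + n"
    using \<open>n > 0\<close> by (simp add: \<rho>_def)
  have K: "K > 0" "K\<^sup>2 = (D + \<rho>)\<^sup>2 + n"
    using \<open>n > 0\<close> by (simp_all add: K_def add_nonneg_pos)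
  define e where "e = complex_of_real (D + \<rho>)"
  define k where "k = complex_of_real K"
  have bc: "b - c = 2 * of_real D"
    using cnj_eq_self[OF re_part(2)] cnj_eq_self[OF re_part(3)] by (simp add: D_def complex_eq_iff)
  have norm: "octonion_norm2 x = of_real n"
    by (simp add: n_def octonion_norm2_real re_part)
  have k: "k \<noteq> 0" "k * k = e * e + octonion_norm2 x" "cnj k = k" "cnj e = e"
    using K by (auto simp: k_def e_def norm power2_eq_square simp flip: of_real_mult of_real_add)
  have e: "e * (b - c) + 2 * octonion_norm2 x = k * k"
  proof -
    have "2 * (D + \<rho>) * D + 2 * n = K\<^sup>2"
      unfolding K(2) using rho2 by (simp add: power2_eq_square algebra_simps)
    then have "complex_of_real (2 * (D + \<rho>) * D + 2 * n) = of_real (K\<^sup>2)"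
      by simp
    then show ?thesis
      by (simp add: bc e_def k_def norm power2_eq_square algebra_simps)
  qed
  \<comment> \<open>The lower block of \<open>s\<close> bisects the traceless part of the block of \<open>h\<close> and \<open>diag(\<rho>, - \<rho>)\<close>.\<close>
  define s where "s = Albert (- 1) (e / k) (- e / k) (octonion_scale (1 / k) x) 0 0"
  have "octonion_norm2 x = k * k - e * e"
    using k(2) by simp
  then have adj: "adj s = s"
    using k(1) by (simp add: s_def adj_def albert_eq_iff octonion_norm2_scale octonion_linear
        octonion_norm2_zero power2_eq_square field_simps)
  have "reflection s"
    using adj by (intro reflectionI) (simp_all add: s_def star_def bar_linear k(3,4) re_part
        tr_def octonion_linear albert_eq_iff)
  moreover have "Uop s (diag 1 0 0) = diag 1 0 0"
    by (simp add: Uop_def adj) (simp add: s_def diag_def tr_def cross_def albert_eq_iff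
        octonion_linear)
  moreover have "o1 (Uop s h) = 0 \<and> o2 (Uop s h) = 0 \<and> o3 (Uop s h) = 0"
  proof -
    have "tr s h = - a + (e * (b - c) + 2 * octonion_norm2 x) / k"
      using k(1) by (simp add: s_def h tr_def octonion_linear octonion_ip_self octonion_norm2_zero
          field_simps)
    then have "tr s h = - a + k"
      using k(1) by (simp add: e)
    then show ?thesis
      using k(1) by (simp add: Uop_def adj) (simp add: s_def h cross_def octonion_linear
          octonion_eq_iff field_simps)
  qed
  then have "Uop s h = diag (d1 (Uop s h)) (d2 (Uop s h)) (d3 (Uop s h))"
    by (simp add: albert_eq_iff)
  ultimately show ?thesis
    using jordan_aut_Uop by blast
qed

lemma diagonalise_hermitian:
  assumes "star h = h"
  shows "\<exists>\<phi> a b c. jordan_aut \<phi> \<and> \<phi> h = diag a b c"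
proof -
  obtain t :: real where t: "nrm (h - of_real t *\<^sub>A 1) = 0"
    using hermitian_eigenvalue[OF assms] by blast
  define y where "y = h - of_real t *\<^sub>A 1"
  have y: "star y = y" "nrm y = 0"
    using assms t by (simp_all add: y_def star_linear)
  obtain p \<mu> where p: "star p = p" "adj p = 0" "tr p 1 = 1" "jor p y = \<mu> *\<^sub>A p"
    using exists_eigenprojection[OF y] by blast
  obtain \<phi> where \<phi>: "jordan_aut \<phi>" "\<phi> p = diag 1 0 0"
    using rank_one_to_first[OF p(1-3)] by blast
  have "jor (diag 1 0 0) (\<phi> y) = \<mu> *\<^sub>A diag 1 0 0"
    using arg_cong[OF p(4), of \<phi>] \<phi> by (simp add: jordan_aut_jor jordan_aut_linear)
  \<comment> \<open>The product with the first matrix unit halves the entries \<open>o2\<close> and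
    \<open>o3\<close>, so an eigenprojection forces them to vanish.\<close>
  then have "o2 (jor (diag 1 0 0) (\<phi> y)) = 0" "o3 (jor (diag 1 0 0) (\<phi> y)) = 0"
    by (simp_all add: octonion_linear)
  then have "o2 (\<phi> y) = 0" "o3 (\<phi> y) = 0"
    by (simp_all add: jor_sel octonion_linear) (simp_all add: octonion_eq_iff)
  moreover have "star (\<phi> y) = \<phi> y"
    using y \<phi>(1) by (simp flip: jordan_aut_star)
  ultimately obtain \<psi> a b c where \<psi>: "jordan_aut \<psi>" "\<psi> (\<phi> y) = diag a b c"
    using diagonalise_block by blast
  have "h = y + of_real t *\<^sub>A 1"
    by (simp add: y_def)
  then have "\<psi> (\<phi> h) = diag (a + of_real t) (b + of_real t) (c + of_real t)"
    using \<phi> \<psi> by (simp add: jordan_aut_linear) (simp add: diag_linear)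
  then show ?thesis
    using jordan_aut_comp[OF \<psi>(1) \<phi>(1)] by blast
qed

section \<open>Diagonalisation of unitary elements\<close>

lemma albert_unitary_jor_commute:
  assumes "albert_unitary u"
  shows "jor u (jor (star u) x) = jor (star u) (jor u x)"
proof -
  \<comment> \<open>Since \<open>jor u (star u) = 1\<close>, the first term of {u,u,x} is already
    \<open>x\<close>, and the other two must cancel.\<close>
  have "trip u u x = x"
    using assms by (simp add: albert_unitary_def)
  then show ?thesis
    by (simp add: trip_eq_jor albert_unitary_jor[OF assms] jor_one jor_commute[of "jor u x"])
qed

definition re_part :: "albert \<Rightarrow> albert" where
  "re_part u = (1/2) *\<^sub>A (u + star u)"

definition im_part :: "albert \<Rightarrow> albert" where
  "im_part u = (\<i>/2) *\<^sub>A (star u - u)"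

lemma re_part_im_part: "u = re_part u + \<i> *\<^sub>A im_part u" "star (re_part u) = re_part u" "star
    (im_part u) = im_part u"
  by (rule tr_nondegenerate, simp add: re_part_def im_part_def tr_linear star_linear field_simps)+

lemma jordan_aut_re_part_im_part:
  assumes "jordan_aut \<phi>"
  shows "re_part (\<phi> u) = \<phi> (re_part u)" "im_part (\<phi> u) = \<phi> (im_part u)"
  by (simp_all add: re_part_def im_part_def jordan_aut_linear[OF assms] jordan_aut_star[OF assms])

lemma albert_unitary_re_part_im_part_commute:
  assumes "albert_unitary u"
  shows "jor (re_part u) (jor (im_part u) x) = jor (im_part u) (jor (re_part u) x)"
  by (rule tr_nondegenerate)
    (simp add: re_part_def im_part_def jor_linear tr_linear albert_unitary_jor_commute[OF assms]
        field_simps)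

text \<open>By commutation, the products of \<open>im_part u\<close> with matrix units are
  eigenvectors of the product with \<open>diag a b c\<close>. That operator scales \<open>o3\<close>
  by (a + b)/2, which differs from the eigenvalue \<open>a\<close> unless a = b; the other entries
  are alike.\<close>

lemma albert_unitary_im_part_off_diagonal:
  assumes "albert_unitary u" and re_part: "re_part u = diag a b c"
  shows "a \<noteq> b \<Longrightarrow> o3 (im_part u) = 0" "a \<noteq> c \<Longrightarrow> o2 (im_part u) = 0" "b \<noteq> c \<Longrightarrow> o1 (im_part u) = 0"
proof -
  note comm = albert_unitary_re_part_im_part_commute[OF assms(1), unfolded re_part]
  have 1: "jor (diag a b c) (jor (im_part u) (diag 1 0 0)) = a *\<^sub>A jor (im_part u) (diag 1 0 0)"
    "jor (diag a b c) (jor (im_part u) (diag 0 1 0)) = b *\<^sub>A jor (im_part u) (diag 0 1 0)"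
    unfolding comm by (simp_all add: albert_eq_iff jor_sel octonion_linear)
  have cancel: "x = 0" if "octonion_scale (1/2) (octonion_scale (s + t) (octonion_scale (1/2) x)) =
      octonion_scale s (octonion_scale (1/2) x)" "s \<noteq> t" for s t and x :: "complex octonion"
  proof -
    have "octonion_scale ((s + t) / 4) x = octonion_scale (s / 2) x"
      using that(1) by (simp only: octonion_scale_linear(5)) simp
    then have "(s + t) / 4 = s / 2 \<or> x = 0"
      by (auto simp: octonion_eq_iff)
    then show ?thesis
      using that(2) by (auto simp: field_simps)
  qed
  show "o3 (im_part u) = 0" if "a \<noteq> b"
    using 1(1)[THEN arg_cong, of o3] that by (intro cancel[of a b]) (simp_all add: jor_sel
        octonion_linear)
  show "o2 (im_part u) = 0" if "a \<noteq> c"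
    using 1(1)[THEN arg_cong, of o2] that by (intro cancel[of a c]) (simp_all add: jor_sel
        octonion_linear add.commute)
  show "o1 (im_part u) = 0" if "b \<noteq> c"
    using 1(2)[THEN arg_cong, of o1] that by (intro cancel[of b c]) (simp_all add: jor_sel
        octonion_linear)
qed

text \<open>The imaginary part has block form. If b = c, the block can be diagonalised without
  moving \<open>re_part u\<close>; otherwise it is diagonal already.\<close>

lemma diagonalise_albert_unitary_aux:
  assumes "albert_unitary u" and re_part: "re_part u = diag a b c" and "a \<noteq> b" "a \<noteq> c"
  shows "\<exists>\<phi> \<alpha> \<beta> \<gamma>. jordan_aut \<phi> \<and> \<phi> u = diag \<alpha> \<beta> \<gamma>"
proof -
  have 0: "o2 (im_part u) = 0" "o3 (im_part u) = 0"
    using albert_unitary_im_part_off_diagonal[OF assms(1,2)] assms(3,4) by auto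
  obtain \<phi> a' b' c' where \<phi>: "jordan_aut \<phi>" "\<phi> (re_part u) = diag a b c" "\<phi> (im_part u) = diag a'
      b' c'"
  proof (cases "b = c")
    case True
    obtain \<phi> a' b' c' where \<phi>: "jordan_aut \<phi>" "\<phi> (diag 1 0 0) = diag 1 0 0" "\<phi> (im_part u) = diag
        a' b' c'"
      using diagonalise_block[OF re_part_im_part(3) 0] by blast
    have "re_part u = b *\<^sub>A 1 + (a - b) *\<^sub>A diag 1 0 0"
      unfolding re_part True by (simp add: albert_eq_iff octonion_linear)
    then have "\<phi> (re_part u) = re_part u"
      using \<phi> by (simp add: jordan_aut_linear)
    then show ?thesis
      using that \<phi> re_part by metis
  next
    case False
    then have "im_part u = diag (d1 (im_part u)) (d2 (im_part u)) (d3 (im_part u))"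
      using 0 albert_unitary_im_part_off_diagonal(3)[OF assms(1,2)] by (simp add: albert_eq_iff)
    then show ?thesis
      using that[OF jordan_aut_id] re_part by metis
  qed
  have "\<phi> u = \<phi> (re_part u) + \<i> *\<^sub>A \<phi> (im_part u)"
    using arg_cong[OF re_part_im_part(1)[of u], of \<phi>] by (simp add: jordan_aut_linear[OF \<phi>(1)])
  then have "\<phi> u = diag (a + \<i> * a') (b + \<i> * b') (c + \<i> * c')"
    by (simp add: \<phi>(2,3) diag_linear)
  then show ?thesis
    using \<phi>(1) by blast
qed

text \<open>Either some eigenvalue of the real part is simple, and a swap moves it to the first
  place, or the real part is a scalar and only the imaginary part needs diagonalising.\<close>

lemma diagonalise_albert_unitary:
  assumes "albert_unitary u"
  shows "\<exists>\<phi> \<alpha> \<beta> \<gamma>. jordan_aut \<phi> \<and> \<phi> u = diag \<alpha> \<beta> \<gamma>"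
proof -
  obtain \<psi> a b c where \<psi>: "jordan_aut \<psi>" "\<psi> (re_part u) = diag a b c"
    using diagonalise_hermitian[OF re_part_im_part(2)] by blast
  have step: ?thesis if \<theta>: "jordan_aut \<theta>" and d: "\<theta> (diag a b c) = diag a' b' c'" "a' \<noteq> b'" "a' \<noteq>
      c'" for \<theta> a' b' c'
  proof -
    have j: "jordan_aut (\<lambda>x. \<theta> (\<psi> x))"
      using \<theta> \<psi>(1) by (rule jordan_aut_comp)
    have "albert_unitary (\<theta> (\<psi> u))" "re_part (\<theta> (\<psi> u)) = diag a' b' c'"
      using triple_aut_albert_unitary[OF _ assms] j d(1) \<psi>(2) jordan_aut_re_part_im_part(1)[OF j]
          by (auto simp: jordan_aut_def)
    then obtain \<omega> \<alpha> \<beta> \<gamma> where "jordan_aut \<omega>" "\<omega> (\<theta> (\<psi> u)) = diag \<alpha> \<beta> \<gamma>"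
      using diagonalise_albert_unitary_aux d(2,3) by blast
    then show ?thesis
      using jordan_aut_comp[OF _ j] by blast
  qed
  consider "a \<noteq> b" "a \<noteq> c" | "b \<noteq> a" "b \<noteq> c" | "c \<noteq> b" "c \<noteq> a" | "a = b" "b = c"
    by metis
  then show ?thesis
  proof cases
    case 1 then show ?thesis using step[OF jordan_aut_id] by blast
  next
    case 2 then show ?thesis using swap12 step by metis
  next
    case 3 then show ?thesis using swap13 step by metis
  next
    case 4
    obtain \<phi> a' b' c' where \<phi>: "jordan_aut \<phi>" "\<phi> (im_part u) = diag a' b' c'"
      using diagonalise_hermitian[OF re_part_im_part(3)] by blast
    have "\<psi> (re_part u) = \<psi> (a *\<^sub>A 1)"
      unfolding \<psi>(2) jordan_aut_linear[OF \<psi>(1)] using 4 by (simp add: albert_eq_iff octonion_linear)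
    then have "re_part u = a *\<^sub>A 1"
      using \<psi>(1) by (metis bij_is_inj injD jordan_aut_def triple_autD(1))
    then have "\<phi> u = a *\<^sub>A 1 + \<i> *\<^sub>A \<phi> (im_part u)"
      using arg_cong[OF re_part_im_part(1)[of u], of \<phi>] by (simp add: jordan_aut_linear[OF \<phi>(1)])
    then show ?thesis
      using \<phi> by (simp add: diag_linear) metis
  qed
qed

section \<open>The determinant and chains of unitaries\<close>

lemma albert_unitary_diag:
  assumes "albert_unitary (diag a b c)"
  shows "cmod a = 1" "cmod b = 1" "cmod c = 1"
proof -
  have "jor (diag a b c) (star (diag a b c)) = 1"
    by (rule albert_unitary_jor[OF assms])
  then have "a * cnj a = 1" "b * cnj b = 1" "c * cnj c = 1"
    by (simp_all add: albert_eq_iff jor_sel diag_linear(4) octonion_linear)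
  moreover have "cmod z = 1" if "z * cnj z = 1" for z
  proof -
    have "complex_of_real ((cmod z)\<^sup>2) = of_real 1"
      using that by (simp add: mult_cnj_cmod)
    then show ?thesis
      by (simp only: of_real_eq_iff power2_eq_1_iff) (smt (verit) norm_ge_zero)
  qed
  ultimately show "cmod a = 1" "cmod b = 1" "cmod c = 1"
    by blast+
qed

text \<open>Minimality can be stated with \<open>jor\<close> because {p,p,x} =
  \<open>jor p x\<close> for a projection \<open>p\<close>.\<close>

definition minimal_idempotent :: "albert \<Rightarrow> bool" where
  "minimal_idempotent p \<longleftrightarrow> star p = p \<and> jor p p = p \<and> p \<noteq> 0 \<and> (\<forall>x. jor p x = x \<longleftrightarrow> (\<exists>c. x = c *\<^sub>A p))"

lemma minimal_projection_albert_mat: "minimal_projection (albert_mat p) \<longleftrightarrow> minimal_idempotent p"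
proof -
  have p: "projection (albert_mat p) \<longleftrightarrow> star p = p \<and> jor p p = p"
    by (auto simp: projection_def albert_mat_in_C6 octmat_star_albert_mat jordan_albert_mat)
  have tri: "trip p p x = jor p x" if "star p = p" "jor p p = p" for x
    using that by (simp add: trip_eq_jor jor_commute[of "jor p x"])
  have "{x \<in> C6. triple (albert_mat p) (albert_mat p) x = x} = albert_mat ` {x. trip p p x = x}"
    by (auto simp: C6_eq_range_albert_mat triple_albert_mat)
  moreover have "range (\<lambda>\<alpha>. octmat_scale \<alpha> (albert_mat p)) = albert_mat ` range (\<lambda>c. c *\<^sub>A p)"
    by (simp add: image_image albert_mat_linear)
  moreover have "inj albert_mat"
    by (simp add: inj_def)
  ultimately have "{x \<in> C6. triple (albert_mat p) (albert_mat p) x = x} = range (\<lambda>\<alpha>. octmat_scale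
      \<alpha> (albert_mat p)) \<longleftrightarrow>
      {x. trip p p x = x} = range (\<lambda>c. c *\<^sub>A p)"
    by (simp add: inj_image_eq_iff)
  also have "\<dots> \<longleftrightarrow> (\<forall>x. trip p p x = x \<longleftrightarrow> (\<exists>c. x = c *\<^sub>A p))"
    by (simp add: set_eq_iff image_iff)
  finally have "{x \<in> C6. triple (albert_mat p) (albert_mat p) x = x} = range (\<lambda>\<alpha>. octmat_scale \<alpha>
      (albert_mat p)) \<longleftrightarrow>
      (\<forall>x. trip p p x = x \<longleftrightarrow> (\<exists>c. x = c *\<^sub>A p))" .
  then show ?thesis
    using tri albert_mat_inject[of p 0] unfolding minimal_projection_def minimal_idempotent_def p
        by (auto simp: albert_mat_linear)
qed

lemma jordan_aut_minimal_idempotent: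
  assumes "jordan_aut \<phi>" "minimal_idempotent p"
  shows "minimal_idempotent (\<phi> p)"
proof -
  have inj: "\<phi> x = \<phi> y \<longleftrightarrow> x = y" for x y
    using assms(1) by (metis bij_is_inj injD jordan_aut_def triple_autD(1))
  have "jor (\<phi> p) x = x \<longleftrightarrow> (\<exists>c. x = c *\<^sub>A \<phi> p)" for x
  proof -
    obtain z where "x = \<phi> z"
      using assms(1) by (metis bij_pointE jordan_aut_def triple_autD(1))
    then show ?thesis
      using assms(2) by (simp add: minimal_idempotent_def inj flip: jordan_aut_jor[OF assms(1)]
          jordan_aut_linear(3)[OF assms(1)])
  qed
  moreover have "\<phi> p \<noteq> 0"
    using inj[of p 0] assms by (simp add: jordan_aut_linear minimal_idempotent_def)
  ultimately show ?thesis
    using assms by (simp add: minimal_idempotent_def flip: jordan_aut_jor jordan_aut_star)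
qed

definition frame :: "3 \<Rightarrow> albert" where
  "frame j = diag (if j = 1 then 1 else 0) (if j = 2 then 1 else 0) (if j = 3 then 1 else 0)"

lemma octonion_half_eq_self: "octonion_scale (1/2) x = x \<longleftrightarrow> x = 0" for x :: "complex octonion"
  by (auto simp: octonion_eq_iff)

lemma minimal_idempotent_frame: "minimal_idempotent (frame j)"
proof -
  have "\<forall>j. minimal_idempotent (frame j)"
    by (auto simp: forall_3 minimal_idempotent_def frame_def albert_eq_iff star_def bar_linear
        jor_sel octonion_linear octonion_half_eq_self
       intro!: exI[of _ "d1 _"])
  then show ?thesis ..
qed

lemma trip_frame: "j \<noteq> k \<Longrightarrow> trip (frame j) (frame k) x = 0"
proof -
  have "\<forall>j k. j \<noteq> k \<longrightarrow> trip (frame j) (frame k) x = 0"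
    by (simp add: forall_3 trip_eq_jor frame_def albert_eq_iff star_def bar_linear jor_sel
        octonion_linear)
  then show "j \<noteq> k \<Longrightarrow> trip (frame j) (frame k) x = 0"
    by blast
qed

lemma albert_tripotent_frame: "albert_tripotent (frame j)"
proof -
  have "trip (frame j) (frame j) (frame j) = frame j"
    using minimal_idempotent_frame[of j] by (simp add: trip_eq_jor minimal_idempotent_def)
  then show ?thesis
    by (simp add: albert_tripotent_def trip_eq_Uop)
qed

lemma orthogonal_tripotents_albert_mat:
  "orthogonal_tripotents (albert_mat p) (albert_mat q) \<longleftrightarrow> albert_tripotent p \<and> albert_tripotent q \<and>
      (\<forall>x. trip p q x = 0)"
  by (simp add: orthogonal_tripotents_def tripotent_albert_mat C6_eq_range_albert_mat
      triple_albert_mat albert_mat_linear(4)[symmetric] del: albert_mat_linear(4))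

lemma spectral_decomposition_exists:
  assumes "albert_unitary u"
  shows "\<exists>\<alpha> p. spectral_decomposition (albert_mat u) \<alpha> p"
proof -
  obtain \<phi> a b c where \<phi>: "jordan_aut \<phi>" "\<phi> u = diag a b c"
    using diagonalise_albert_unitary[OF assms] by blast
  define \<psi> where "\<psi> = inv \<phi>"
  have \<psi>: "jordan_aut \<psi>" "\<psi> (\<phi> u) = u"
    using \<phi>(1) jordan_aut_inv by (auto simp: \<psi>_def) (metis bij_is_inj inv_f_f jordan_aut_def
        triple_autD(1))
  have t: "triple_aut \<psi>"
    using \<psi>(1) by (simp add: jordan_aut_def)
  define \<alpha> :: "3 \<Rightarrow> complex" where "\<alpha> j = (if j = 1 then a else if j = 2 then b else c)" for j
  have "cmod a = 1" "cmod b = 1" "cmod c = 1"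
    using albert_unitary_diag triple_aut_albert_unitary[OF _ assms, of \<phi>] \<phi> by (auto simp:
        jordan_aut_def)
  then have "cmod (\<alpha> j) = 1" for j
    by (simp add: \<alpha>_def)
  moreover have "minimal_projection (albert_mat (\<psi> (frame j)))" for j
    by (simp add: minimal_projection_albert_mat jordan_aut_minimal_idempotent \<psi>
        minimal_idempotent_frame)
  moreover have "orthogonal_tripotents (albert_mat (\<psi> (frame j))) (albert_mat (\<psi> (frame k)))" if
      "j \<noteq> k" for j k
  proof -
    have "trip (\<psi> (frame j)) (\<psi> (frame k)) x = 0" for x
    proof -
      obtain z where "x = \<psi> z"
        using t by (metis bij_pointE triple_autD(1))
      then show ?thesis
        using that \<psi>(1) by (simp add: trip_frame jordan_aut_linear flip: triple_aut_trip[OF t])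
    qed
    then show ?thesis
      by (simp add: orthogonal_tripotents_albert_mat triple_aut_albert_tripotent t
          albert_tripotent_frame)
  qed
  moreover have "albert_mat u = (\<Sum>j\<in>UNIV. octmat_scale (\<alpha> j) (albert_mat (\<psi> (frame j))))"
  proof -
    have "\<phi> u = a *\<^sub>A frame 1 + b *\<^sub>A frame 2 + c *\<^sub>A frame 3"
      by (simp add: \<phi>(2) frame_def albert_eq_iff octonion_linear)
    then have "u = a *\<^sub>A \<psi> (frame 1) + b *\<^sub>A \<psi> (frame 2) + c *\<^sub>A \<psi> (frame 3)"
      using \<psi> by (metis jordan_aut_linear(1,3))
    then show ?thesis
      by (simp add: sum_3 \<alpha>_def flip: albert_mat_linear)
  qed
  ultimately have "spectral_decomposition (albert_mat u) \<alpha> (\<lambda>j. albert_mat (\<psi> (frame j)))"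
    by (simp add: spectral_decomposition_def)
  then show ?thesis
    by blast
qed

text \<open>Diagonalised, \<open>p\<close> has entries 0 and 1. Each matrix unit at an entry 1 is
  fixed by \<open>p\<close>, hence a multiple of it, so there is exactly one such entry.\<close>

lemma minimal_idempotent_rank_one:
  assumes "minimal_idempotent p"
  shows "adj p = 0" "tr p 1 = 1"
proof -
  obtain \<phi> a b c where \<phi>: "jordan_aut \<phi>" "\<phi> p = diag a b c"
    using diagonalise_hermitian[of p] assms by (auto simp: minimal_idempotent_def)
  have m: "minimal_idempotent (diag a b c)"
    using jordan_aut_minimal_idempotent[OF \<phi>(1) assms] \<phi>(2) by simp
  then have "a = 0 \<or> a = 1" "b = 0 \<or> b = 1" "c = 0 \<or> c = 1" "a \<noteq> 0 \<or> b \<noteq> 0 \<or> c \<noteq> 0"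
    by (auto simp: minimal_idempotent_def albert_eq_iff jor_sel octonion_linear)
  moreover have "\<exists>t. frame j = t *\<^sub>A diag a b c" if "jor (diag a b c) (frame j) = frame j" for j
    using m that by (simp add: minimal_idempotent_def)
  from this[of 1] this[of 2] this[of 3] have "a = 1 \<Longrightarrow> b = 0 \<and> c = 0" "b = 1 \<Longrightarrow> a = 0 \<and> c = 0" "c =
      1 \<Longrightarrow> a = 0 \<and> b = 0"
    by (auto simp: frame_def albert_eq_iff jor_sel octonion_linear)
  ultimately consider "a = 1" "b = 0" "c = 0" | "a = 0" "b = 1" "c = 0" | "a = 0" "b = 0" "c = 1"
    by metis
  then have "adj (\<phi> p) = 0" "tr (\<phi> p) 1 = 1"
    by (cases, simp_all add: \<phi>(2) adj_def tr_def albert_eq_iff octonion_linear octonion_norm2_zero)+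
  then have "\<phi> (adj p) = \<phi> 0" "tr (\<phi> p) (\<phi> 1) = 1"
    using \<phi>(1) by (simp_all add: jordan_aut_adj jordan_aut_linear)
  then show "adj p = 0" "tr p 1 = 1"
    using \<phi>(1) by (metis bij_is_inj injD jordan_aut_def triple_autD(1), simp add: jordan_aut_tr)
qed

lemma rank_one_nrm:
  assumes "adj x = 0"
  shows "nrm x = 0"
  using tr_adj_self[of x] assms by (simp add: tr_linear)

lemma nrm_rank_one_sum:
  assumes "adj x = 0" "adj y = 0" "adj z = 0"
  shows "nrm (a *\<^sub>A x + b *\<^sub>A y + c *\<^sub>A z) = a * b * c * tr (cross x y) z"
  using assms
  by (simp add: nrm_add adj_add adj_scale nrm_scale tr_linear cross_linear rank_one_nrm)

text \<open>Shows that the product of the eigenvalues is independent of the decomposition. On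
  combinations of rank-one elements \<open>nrm\<close> has only the mixed term, and its constant is
  1 because \<open>nrm 1 = 1\<close>.\<close>

lemma spectral_decomposition_nrm:
  assumes "spectral_decomposition (albert_mat u) \<alpha> p"
  shows "(\<Prod>j\<in>UNIV. \<alpha> j) = nrm u"
proof -
  have "\<exists>q. p j = albert_mat q" for j
    using assms C6_eq_range_albert_mat by (auto simp: spectral_decomposition_def
        minimal_projection_def projection_def)
  then obtain q where q: "\<And>j. p j = albert_mat (q j)"
    by metis
  have m: "minimal_idempotent (q j)" for j
    using assms by (simp add: spectral_decomposition_def q minimal_projection_albert_mat)
  have adj: "adj (q j) = 0" and tr1: "tr (q j) 1 = 1" for j
    using minimal_idempotent_rank_one m by blast+
  have tr2: "tr (q j) (q j) = 1" for j
    using m[of j] tr1[of j] tr_jor[of "q j" "q j"] by (simp add: minimal_idempotent_def)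
  have orth: "tr (q j) (q k) = 0" if "j \<noteq> k" for j k
  proof -
    have "trip (q j) (q k) 1 = 0"
      using assms that by (simp add: spectral_decomposition_def q orthogonal_tripotents_albert_mat)
    then have "jor (q j) (q k) = 0"
      using m[of k] by (simp add: trip_eq_jor jor_one minimal_idempotent_def)
    then show ?thesis
      using tr_jor[of "q j" "q k"] by (simp add: tr_linear)
  qed
  have "u = \<alpha> 1 *\<^sub>A q 1 + \<alpha> 2 *\<^sub>A q 2 + \<alpha> 3 *\<^sub>A q 3"
    using assms by (simp add: spectral_decomposition_def q sum_3 flip: albert_mat_linear)
  then have u: "nrm u = \<alpha> 1 * \<alpha> 2 * \<alpha> 3 * tr (cross (q 1) (q 2)) (q 3)"
    by (simp add: nrm_rank_one_sum adj)
  \<comment> \<open>The three projections sum to 1: the hermitian defect \<open>z\<close> has T(z,z)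
    = 3 - 6 + 3 = 0.\<close>
  define z where "z = 1 - (q 1 + q 2 + q 3)"
  have "star z = z"
    using m by (simp add: z_def star_linear minimal_idempotent_def)
  moreover have "tr z z = 0"
    by (simp add: z_def tr_linear tr_one_one tr1 tr2 orth tr_commute[of 1 "q _"])
  ultimately have "z = 0"
    using tr_star_eq_0 by metis
  then have "q 1 + q 2 + q 3 = 1"
    by (simp add: z_def)
  then have "tr (cross (q 1) (q 2)) (q 3) = 1"
    using nrm_rank_one_sum[OF adj adj adj, of 1 1 1 2 1 3] nrm_one by simp
  then show ?thesis
    unfolding u UNIV_3 by (simp add: mult_ac)
qed

lemma dt_albert_mat:
  assumes "albert_unitary u"
  shows "dt (albert_mat u) = nrm u"
  unfolding dt_def using spectral_decomposition_exists[OF assms]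
  by (intro the_equality) (auto simp: spectral_decomposition_nrm)

text \<open>The intermediate tripotents of a chain are not assumed unitary; the condition |N| = 1
  passes upwards along the order instead.\<close>

lemma le_h_nrm:
  assumes "le_h (albert_mat x) (albert_mat y)" "cmod (nrm x) = 1"
  shows "cmod (nrm y) = 1" "(nrm y)\<^sup>2 = (nrm x)\<^sup>2"
proof -
  have "nrm x = (nrm y)\<^sup>2 * cnj (nrm x)"
    using assms(1) nrm_Uop[of y "star x"] by (simp add: le_h_albert_mat nrm_star)
  then have "nrm x * nrm x = (nrm y)\<^sup>2 * (cnj (nrm x) * nrm x)"
    by (metis mult.assoc)
  then show *: "(nrm y)\<^sup>2 = (nrm x)\<^sup>2"
    using cnj_mult_cmod_1[OF assms(2)] by (simp add: power2_eq_square)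
  have "(cmod (nrm y))\<^sup>2 = 1"
    using arg_cong[OF *, of cmod] assms(2) by (simp add: norm_power)
  then show "cmod (nrm y) = 1"
    by (simp add: power2_eq_1_iff) (smt (verit) norm_ge_zero)
qed

lemma le_h_chain_nrm:
  fixes k :: nat
  assumes "v k = albert_mat x" "cmod (nrm x) = 1" "\<And>j. j \<in> {1..k} \<Longrightarrow> le_h (v j) (v (j - 1))"
  shows "\<exists>y. v 0 = albert_mat y \<and> (nrm y)\<^sup>2 = (nrm x)\<^sup>2"
  using assms
proof (induction k arbitrary: x)
  case 0
  then show ?case by auto
next
  case (Suc k)
  have le: "le_h (albert_mat x) (v k)"
    using Suc.prems(3)[of "Suc k"] Suc.prems(1) by simp
  then obtain y where y: "v k = albert_mat y"
    using C6_eq_range_albert_mat by (auto simp: le_h_def tripotent_def)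
  then have "cmod (nrm y) = 1" "(nrm y)\<^sup>2 = (nrm x)\<^sup>2"
    using le_h_nrm le Suc.prems(2) by auto
  then show ?case
    using Suc.IH[OF y] Suc.prems(3) by simp
qed

section \<open>Explicit chains between unitaries\<close>

definition h_sim :: "albert \<Rightarrow> albert \<Rightarrow> bool" where
  "h_sim x y \<longleftrightarrow> albert_tripotent x \<and> albert_tripotent y \<and> Uop y (star x) = x \<and> Uop x (star y) = y"

lemma sim_albert_mat: "sim le_h (albert_mat x) (albert_mat y) \<longleftrightarrow> h_sim x y"
  by (auto simp: sim_def le_h_albert_mat h_sim_def)

lemma triple_aut_h_sim: "triple_aut \<phi> \<Longrightarrow> h_sim x y \<Longrightarrow> h_sim (\<phi> x) (\<phi> y)"
  unfolding h_sim_def using triple_aut_albert_tripotent triple_autD(4) by metis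

lemma triple_aut_h_sim_relpowp:
  assumes "triple_aut \<phi>"
  shows "(h_sim ^^ k) x y \<Longrightarrow> (h_sim ^^ k) (\<phi> x) (\<phi> y)"
proof (induction k arbitrary: y)
  case (Suc k)
  obtain z where "(h_sim ^^ k) x z" "h_sim z y"
    using Suc.prems by (rule relpowp_Suc_E)
  then show ?case
    using triple_aut_h_sim[OF assms] Suc.IH by (intro relpowp_Suc_I[of k h_sim _ "\<phi> z"])
qed simp

abbreviation scalar_oct :: "complex \<Rightarrow> complex octonion" where
  "scalar_oct x \<equiv> octonion_scale x 1"

text \<open>On matrices with a single scalar 2x2 block, U is the ordinary product
  \<open>x y x\<close>.\<close>

lemma Uop_block:
  "Uop (Albert p q r (scalar_oct x) 0 0) (Albert a b c (scalar_oct y) 0 0) =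
    Albert (p * p * a) (q * q * b + x * x * c + 2 * q * x * y) (r * r * c + x * x * b + 2 * r * x
        * y)
      (scalar_oct ((q * r + x * x) * y + q * x * b + r * x * c)) 0 0"
  "Uop (Albert p q r 0 0 (scalar_oct x)) (Albert a b c 0 0 (scalar_oct y)) =
    Albert (p * p * a + x * x * b + 2 * p * x * y) (q * q * b + x * x * a + 2 * q * x * y) (r * r
        * c) 0 0
      (scalar_oct ((p * q + x * x) * y + p * x * a + q * x * b))"
  by (simp_all add: albert_eq_iff Uop_def adj_def cross_def tr_def octonion_linear
      octonion_norm2_zero)
    (simp_all add: octonion_eq_iff octonion_norm2_def octonion_ip_def power2_eq_square
        algebra_simps)

lemma diag_chain:
  assumes "cmod a = 1" "cmod b = 1" "cmod c = 1" "a * b * c = 1"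
  shows "(h_sim ^^ 4) (diag a b c) 1"
proof -
  \<comment> \<open>The blocks diag(b,c) and diag(\<open>cnj a\<close>,1) have the same determinant
    \<open>cnj a\<close>, because abc = 1. An element exchanging entries 2 and 3 with off-diagonal
    scalar \<open>d\<close> is linked to both once \<open>d * d = cnj a\<close>.\<close>
  define d where "d = cnj (csqrt a)"
  have d: "d * d = cnj a" "cnj d * cnj d = a"
    by (simp_all add: d_def flip: power2_eq_square complex_cnj_power)
  have cnj: "a * cnj a = 1" "b * cnj b = 1" "c * cnj c = 1"
    using assms cnj_mult_cmod_1 by auto
  have d1: "d * cnj d = 1"
  proof -
    have "cmod d * cmod d = 1"
      using arg_cong[OF d(1), of cmod] assms(1) by (simp add: norm_mult)
    then have "cmod d = 1"
      by (metis abs_norm_cancel abs_square_eq_1 power2_eq_square)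
    then show ?thesis
      by (rule cnj_mult_cmod_1)
  qed
  have b: "b = cnj a * cnj c"
    using assms(4) cnj by algebra
  have cb: "cnj b = a * c"
    by (simp add: b)
  have E: "a * a * cnj a = a" "b * b * cnj b = b" "c * c * cnj c = c" "cnj a * cnj a * a = cnj a"
    "cnj a * cnj c = b" "cnj a * cnj b = c" "b * c * cnj d = d" "d * d = cnj a"
    "cnj a * a = 1" "cnj a * cnj d = d"
    using cnj d d1 b cb by algebra+
  \<comment> \<open>\<open>v1\<close> and \<open>v3\<close> exchange the diagonal entries 2, 3 and 1, 2; the scalar \<open>d\<close> in
    \<open>v1\<close> comes from applying \<open>U\<close> of a square root of \<open>v2\<close> to the symmetry that exchanges 2 and 3.\<close>
  define v1 where "v1 = Albert a 0 0 (scalar_oct d) 0 0"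
  define v2 where "v2 = diag a (cnj a) 1"
  define v3 where "v3 = Albert 0 0 1 0 0 (scalar_oct 1)"
  have b1: "diag x y z = Albert x y z (scalar_oct 0) 0 0" and b3: "diag x y z = Albert x y z 0 0
      (scalar_oct 0)" for x y z
    by (simp_all add: diag_def octonion_linear)
  have star: "star (Albert x y z (scalar_oct w) 0 0) = Albert (cnj x) (cnj y) (cnj z) (scalar_oct
      (cnj w)) 0 0"
    "star (Albert x y z 0 0 (scalar_oct w)) = Albert (cnj x) (cnj y) (cnj z) 0 0 (scalar_oct (cnj
        w))" for x y z w
    by (simp_all add: star_def bar_linear)
  have "h_sim (diag a b c) v1"
    unfolding h_sim_def albert_tripotent_def v1_def b1 star Uop_block albert.inject
    by (simp add: E cnj)
  moreover have "h_sim v1 v2"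
    unfolding h_sim_def albert_tripotent_def v1_def v2_def b1 star Uop_block albert.inject
    by (simp add: E cnj)
  moreover have "h_sim v2 v3"
    unfolding h_sim_def albert_tripotent_def v3_def v2_def b3 star Uop_block albert.inject
    by (simp add: E cnj)
  moreover have "h_sim v3 1"
    unfolding h_sim_def albert_tripotent_def v3_def diag_linear(3) b3 star Uop_block albert.inject
    by (simp add: E cnj)
  ultimately show ?thesis
    by (auto simp: numeral_eq_Suc relcompp_apply)
qed

lemma albert_unitary_chain_one:
  assumes "albert_unitary u" "nrm u = 1"
  shows "(h_sim ^^ 4) u 1"
proof -
  obtain \<phi> a b c where \<phi>: "jordan_aut \<phi>" "\<phi> u = diag a b c"
    using diagonalise_albert_unitary[OF assms(1)] by blast
  have "albert_unitary (diag a b c)"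
    using triple_aut_albert_unitary[OF _ assms(1), of \<phi>] \<phi> by (simp add: jordan_aut_def)
  moreover have "a * b * c = 1"
    using jordan_aut_nrm[OF \<phi>(1), of u] assms(2) by (simp add: \<phi>(2) nrm_def octonion_linear
        octonion_norm2_zero)
  ultimately have "(h_sim ^^ 4) (\<phi> u) (\<phi> 1)"
    using diag_chain albert_unitary_diag \<phi> by (simp add: jordan_aut_linear)
  moreover have "triple_aut (inv \<phi>)" "inv \<phi> (\<phi> x) = x" for x
    using \<phi>(1) triple_aut_inv by (auto simp: jordan_aut_def triple_aut_def bij_is_inj)
  ultimately show ?thesis
    using triple_aut_h_sim_relpowp by metis
qed

text \<open>After diagonalising, \<open>Uop r\<close> with \<open>r\<close> a diagonal square root
  carries 1 to the diagonal form of \<open>e\<close>.\<close>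

lemma albert_unitary_square_root:
  assumes "albert_unitary e"
  shows "\<exists>\<psi>. triple_aut \<psi> \<and> \<psi> 1 = e"
proof -
  obtain \<phi> a b c where \<phi>: "jordan_aut \<phi>" "\<phi> e = diag a b c"
    using diagonalise_albert_unitary[OF assms] by blast
  have abc: "cmod a = 1" "cmod b = 1" "cmod c = 1"
    using triple_aut_albert_unitary[OF _ assms, of \<phi>] \<phi> albert_unitary_diag by (auto simp:
        jordan_aut_def)
  define r where "r = diag (csqrt a) (csqrt b) (csqrt c)"
  have "regular r"
  proof -
    have sq: "csqrt z * cnj (csqrt z) = 1" if "cmod z = 1" for z
      using that by (intro cnj_mult_cmod_1) (simp add: norm_csqrt)
    have n: "nrm r = csqrt a * csqrt b * csqrt c"
      by (simp add: r_def nrm_def octonion_linear octonion_norm2_zero)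
    then have "cmod (nrm r) = 1"
      using abc by (simp add: norm_mult norm_csqrt)
    moreover have "adj r = nrm r *\<^sub>A star r"
      unfolding n using sq[OF abc(1)] sq[OF abc(2)] sq[OF abc(3)]
      by (simp add: r_def diag_linear) (simp add: diag_def adj_def octonion_linear
          octonion_norm2_zero mult_ac)
    ultimately show ?thesis
      by (simp add: regular_def)
  qed
  moreover have "Uop r 1 = diag a b c"
    by (simp add: r_def albert_eq_iff Uop_def adj_def cross_def tr_def octonion_linear
        octonion_norm2_zero algebra_simps flip: power2_eq_square)
  moreover have "triple_aut (inv \<phi>)" "inv \<phi> (\<phi> e) = e"
    using \<phi>(1) triple_aut_inv by (auto simp: jordan_aut_def triple_aut_def bij_is_inj)
  ultimately have "triple_aut (\<lambda>x. inv \<phi> (Uop r x))" "inv \<phi> (Uop r 1) = e"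
    using triple_aut_comp triple_aut_Uop \<phi>(2) by auto
  then show ?thesis
    by blast
qed

lemma albert_unitary_chain:
  assumes "albert_unitary u" "albert_unitary e" "nrm u = nrm e"
  shows "(h_sim ^^ 4) u e"
proof -
  obtain \<psi> where \<psi>: "triple_aut \<psi>" "\<psi> 1 = e"
    using albert_unitary_square_root[OF assms(2)] by blast
  obtain u' where u': "\<psi> u' = u"
    using \<psi>(1) by (metis bij_pointE triple_autD(1))
  have "inv \<psi> u = u'"
    using \<psi>(1) u' by (metis bij_is_inj inv_f_f triple_autD(1))
  then have "albert_unitary u'"
    using triple_aut_albert_unitary[OF triple_aut_inv[OF \<psi>(1)] assms(1)] by simp
  obtain \<kappa> where \<kappa>: "\<And>x. nrm (\<psi> x) = \<kappa> * nrm x" "cmod \<kappa> = 1"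
    using \<psi>(1) unfolding triple_aut_def by blast
  \<comment> \<open>The automorphism multiplies both norms by the same factor, so equal determinants
    reduce to determinant 1.\<close>
  have "\<kappa> * nrm u' = \<kappa> * 1"
    using \<kappa>(1)[of u'] \<kappa>(1)[of 1] assms(3) by (simp add: u' \<psi>(2) nrm_one)
  then have "nrm u' = 1"
    using \<kappa>(2) by auto
  then show ?thesis
    using triple_aut_h_sim_relpowp[OF \<psi>(1) albert_unitary_chain_one[OF \<open>albert_unitary u'\<close>]] by
        (simp add: u' \<psi>(2))
qed

section \<open>Scalar multiples and assembly of the chains\<close>

lemma albert_unitary_scale:
  assumes "albert_unitary u" "cmod c = 1"
  shows "albert_unitary (c *\<^sub>A u)"
proof -
  have cc: "c * cnj c = 1"
    using assms(2) by (rule cnj_mult_cmod_1)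
  have "Uop (c *\<^sub>A u) (star (c *\<^sub>A u)) = (c * (c * cnj c)) *\<^sub>A Uop u (star u)"
    by (simp add: Uop_scale Uop_linear star_linear power2_eq_square mult_ac)
  moreover have "trip (c *\<^sub>A u) (c *\<^sub>A u) x = (c * cnj c) *\<^sub>A trip u u x" for x
    by (rule tr_nondegenerate) (simp add: trip_def tr_linear cross_linear star_linear algebra_simps)
  ultimately show ?thesis
    using assms(1) by (simp add: albert_unitary_def albert_tripotent_def cc)
qed

lemma sim_chain_le_h:
  assumes "(h_sim ^^ k) x y" "albert_tripotent x"
  shows "sim_chain le_h k (albert_mat x) (albert_mat y)"
proof -
  obtain f where f: "f 0 = x" "f k = y" "\<And>i. i < k \<Longrightarrow> h_sim (f i) (f (Suc i))"
    using assms(1) unfolding relpowp_fun_conv by blast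
  have "albert_tripotent (f j)" if "j \<le> k" for j
    using that f(1,3) assms(2) by (cases j) (auto simp: h_sim_def)
  then show ?thesis
    unfolding sim_chain_def using f
    by (intro exI[of _ "\<lambda>j. albert_mat (f j)"]) (simp add: tripotent_albert_mat sim_albert_mat)
qed

lemma sim_chain_imp_sim_t:
  assumes "sim_chain le k u e"
  shows "sim_t le u e"
proof -
  obtain w where w: "w 0 = u" "w k = e" "\<And>j. j \<le> k \<Longrightarrow> tripotent (w j)" "\<And>j. j < k \<Longrightarrow> sim le (w j) (w
      (Suc j))"
    using assms unfolding sim_chain_def by blast
  \<comment> \<open>\<open>le_t le u e\<close> descends from \<open>e\<close> to \<open>u\<close>,
    so the chain \<open>w\<close> is traversed backwards.\<close>
  have "le (w (k - j)) (w (k - (j - 1)))" if "j \<in> {1..k}" for j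
  proof -
    have "k - (j - 1) = Suc (k - j)" "k - j < k"
      using that by auto
    then show ?thesis
      using w(4)[of "k - j"] by (simp add: sim_def)
  qed
  then have "le_t le u e"
    unfolding le_t_def using w by (intro exI[of _ k] exI[of _ "\<lambda>j. w (k - j)"]) simp
  moreover have "le (w j) (w (j - 1))" if "j \<in> {1..k}" for j
    using w(4)[of "j - 1"] that by (cases j) (auto simp: sim_def)
  then have "le_t le e u"
    unfolding le_t_def using w by (intro exI[of _ k] exI[of _ w]) simp
  ultimately show ?thesis
    by (simp add: sim_t_def)
qed

lemma le_h_imp_le_hc:
  assumes "le_h u e" "u \<in> C6"
  shows "le_hc u e"
proof -
  have "octmat_scale 1 u = u"
    using assms(2) by (auto simp: C6_eq_range_albert_mat simp flip: albert_mat_linear)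
  then show ?thesis
    using assms(1) unfolding le_hc_def le_h_def by (metis norm_one)
qed

lemma sim_le_hc_scale:
  assumes "albert_unitary u" "cmod c = 1"
  shows "sim le_hc (albert_mat u) (albert_mat (c *\<^sub>A u))"
proof -
  have t: "albert_tripotent u" "albert_tripotent (c *\<^sub>A u)"
    using assms albert_unitary_scale by (auto simp: albert_unitary_def)
  have "le_h (octmat_scale c (albert_mat u)) (albert_mat (c *\<^sub>A u))"
    using t by (simp add: le_h_albert_mat albert_tripotent_def flip: albert_mat_linear)
  moreover have "le_h (octmat_scale (cnj c) (albert_mat (c *\<^sub>A u))) (albert_mat u)"
    using t cnj_mult_cmod_1[OF assms(2)] by (simp add: le_h_albert_mat albert_tripotent_def flip:
        albert_mat_linear)
  ultimately show ?thesis
    using t assms(2) unfolding sim_def le_hc_def tripotent_albert_mat by (metis complex_mod_cnj)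
qed

lemma cube_root_unit_complex:
  assumes "cmod w = 1"
  shows "\<exists>c. cmod c = 1 \<and> c ^ 3 = w"
proof -
  have "cis (Arg w) = w"
    using assms by (subst cis_Arg) (auto simp: sgn_eq)
  then have "cis (Arg w / 3) ^ 3 = w"
    using Complex.DeMoivre[of "Arg w / 3" 3] by simp
  then show ?thesis
    by (metis norm_cis)
qed

theorem proposition6p21:
  fixes u e :: octmat
  assumes "unitary u" and "unitary e"
  shows "(sim_t le_h u e \<longleftrightarrow> dt u = dt e \<or> dt u = - dt e) \<and>
         (sim_t le_h u e \<longrightarrow> (\<exists>k\<le>5. sim_chain le_h k u e)) \<and>
         sim_t le_hc u e \<and>
         (\<exists>k\<le>5. sim_chain le_hc k u e)"
proof -
  have "u \<in> range albert_mat" "e \<in> range albert_mat"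
    using assms by (simp_all add: unitary_def tripotent_def flip: C6_eq_range_albert_mat)
  then obtain x y where xy: "u = albert_mat x" "e = albert_mat y"
    by blast
  have x: "albert_unitary x" "albert_tripotent x" "cmod (nrm x) = 1" and y: "albert_unitary y"
      "albert_tripotent y" "cmod (nrm y) = 1"
    using assms albert_unitary_regular by (auto simp: xy unitary_albert_mat albert_unitary_def
        regular_def)
  have dt: "dt u = nrm x" "dt e = nrm y"
    by (simp_all add: xy dt_albert_mat x y)
  have forward: "nrm x = nrm y \<or> nrm x = - nrm y" if sim: "sim_t le_h u e"
  proof -
    obtain k :: nat and v where v: "v 0 = e" "v k = u" "\<And>j. j \<in> {1..k} \<Longrightarrow> le_h (v j) (v (j - 1))"
      using sim unfolding sim_t_def le_t_def by blast
    obtain z where "v 0 = albert_mat z" "(nrm z)\<^sup>2 = (nrm x)\<^sup>2"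
      using le_h_chain_nrm[of v k x] v x(3) xy by blast
    then have "(nrm x)\<^sup>2 = (nrm y)\<^sup>2"
      using v(1) xy(2) by simp
    then show ?thesis
      by (simp add: power2_eq_iff)
  qed
  have chain: "\<exists>k\<le>5. sim_chain le_h k u e" if "nrm x = nrm y \<or> nrm x = - nrm y"
    using that
  proof
    assume "nrm x = nrm y"
    then have "sim_chain le_h 4 u e"
      unfolding xy by (intro sim_chain_le_h albert_unitary_chain x y)
    then show ?thesis
      by (intro exI[of _ 4]) simp
  next
    assume n: "nrm x = - nrm y"
    have m: "albert_unitary (- x)"
      using albert_unitary_scale[OF x(1), of "-1"] by simp
    then have "(h_sim ^^ 4) (- x) y"
      using n by (intro albert_unitary_chain y) (simp_all add: uminus_homogeneous)
    \<comment> \<open>U_x is even in \<open>x\<close> and odd in its argument. This link changes the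
      sign of the cubic norm and is the fifth step.\<close>
    moreover have "h_sim x (- x)"
      using x(2) Uop_scale[of "-1" x "star x"] Uop_linear(3)[of x "-1" "star x"] Uop_scale[of "-1"
          x "- star x"]
      by (simp add: h_sim_def albert_tripotent_def star_linear)
    ultimately have "(h_sim ^^ Suc 4) x y"
      using relpowp_Suc_I2 by metis
    then have "sim_chain le_h 5 u e"
      unfolding xy using sim_chain_le_h[OF _ x(2), of 5 y] by simp
    then show ?thesis
      by blast
  qed
  have "sim_chain le_hc 5 u e"
  proof -
    \<comment> \<open>As N(cx) is the cube of \<open>c\<close> times N(x), a cube root of this
      quotient of unit modulus adjusts the determinant.\<close>
    have "cmod (nrm y * cnj (nrm x)) = 1"
      using x(3) y(3) by (simp add: norm_mult)
    then obtain c where c: "cmod c = 1" "c ^ 3 = nrm y * cnj (nrm x)"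
      using cube_root_unit_complex by blast
    have "nrm (c *\<^sub>A x) = nrm y"
      using cnj_mult_cmod_1[OF x(3)] by (simp add: nrm_scale c(2) mult.assoc)
    then have "sim_chain le_h 4 (albert_mat (c *\<^sub>A x)) (albert_mat y)"
      using albert_unitary_scale[OF x(1) c(1)] y by (intro sim_chain_le_h albert_unitary_chain)
          (auto simp: albert_unitary_def)
    then obtain w where w: "w 0 = albert_mat (c *\<^sub>A x)" "w 4 = albert_mat y" "\<And>j. j \<le> 4 \<Longrightarrow>
        tripotent (w j)"
        "\<And>j. j < 4 \<Longrightarrow> sim le_h (w j) (w (Suc j))"
      unfolding sim_chain_def by blast
    \<comment> \<open>The link from \<open>x\<close> to its multiple is put in front, shifting the
      indices of \<open>w\<close> by one.\<close>
    define w' where "w' j = (case j of 0 \<Rightarrow> albert_mat x | Suc i \<Rightarrow> w i)" for j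
    have "w' 5 = albert_mat y"
      using w(2) by (simp add: w'_def numeral_eq_Suc)
    moreover have "tripotent (w' j)" if "j \<le> 5" for j
      using that w(3) x(2) by (cases j) (auto simp: w'_def tripotent_albert_mat)
    moreover have "sim le_hc (w' j) (w' (Suc j))" if "j < 5" for j
    proof (cases j)
      case 0
      then show ?thesis
        using sim_le_hc_scale[OF x(1) c(1)] w(1) by (simp add: w'_def)
    next
      case (Suc i)
      then have "sim le_h (w i) (w (Suc i))" "tripotent (w i)" "tripotent (w (Suc i))"
        using w(3,4) that by auto
      then show ?thesis
        using Suc by (auto simp: w'_def sim_def tripotent_def intro!: le_h_imp_le_hc)
    qed
    ultimately show ?thesis
      unfolding sim_chain_def xy by (intro exI[of _ w']) (simp add: w'_def)
  qed
  then show ?thesis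
    using forward chain sim_chain_imp_sim_t dt by (metis order_refl)
qed

end
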